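(* If $G$ is a $2$-connected non-complete graph on $n$ vertices, then $\eta(G)\ge 2n-6$.
   Context: All graphs are finite and simple; a $2$-connected graph has at least $3$ vertices. For a connected graph $G=(V,E)$, $d(a,b)$ is the length of a shortest path between $a$ and $b$. The Wiener index is $W(G)=\sum_{\{a,b\}\subseteq V} d(a,b)$ (sum over unordered pairs of vertices). The Szeged index is $\mathrm{Sz}(G)=\sum_{ab\in E} n_{ab}(a)\cdot n_{ab}(b)$, where $n_{ab}(a)$ is the number of vertices strictly closer to $a$ than to $b$, and $n_{ab}(b)$ is the number of vertices strictly closer to $b$ than to $a$. Define $\eta(G)=\mathrm{Sz}(G)-W(G)$. *)

theory Defs
  imports "Graph_Theory.Graph_Theory"
begin

text \<open>
  Finite simple graphs are the instances of the locale \<^locale>\<open>pair_graph\<close>, that is, finite loop-free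
  digraphs whose arc set is symmetric: an undirected edge is represented by two opposite arcs.
\<close>

definition edges :: "'a pair_pre_digraph \<Rightarrow> 'a set set" where
  "edges G = {{a, b} | a b. (a, b) \<in> parcs G}"

definition k_connected :: "nat \<Rightarrow> 'a pair_pre_digraph \<Rightarrow> bool" where
  "k_connected k G \<longleftrightarrow> card (pverts G) > k \<and>
     (\<forall>X \<subseteq> pverts G. card X < k \<longrightarrow>
        Digraph_Component.connected (with_proj G \<restriction> (pverts G - X)))"

text \<open>
  The value is meaningful only if \<open>b\<close> is reachable from \<open>a\<close>; otherwise \<open>LEAST\<close> is unspecified.
\<close>

definition gdist :: "'a pair_pre_digraph \<Rightarrow> 'a \<Rightarrow> 'a \<Rightarrow> nat" where
  "gdist G a b = (LEAST k. \<exists>p. pre_digraph.apath (with_proj G) a p b \<and> length p = k)"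

text \<open>
  Evaluation of a symmetric function of two arguments at an unordered pair; the lemma
  \<open>on_pair_eq\<close> below shows that it does not depend on the order of the arguments.
\<close>

definition on_pair :: "('a \<Rightarrow> 'a \<Rightarrow> 'b) \<Rightarrow> 'a set \<Rightarrow> 'b" where
  "on_pair f e = (THE y. \<exists>a b. e = {a, b} \<and> y = f a b)"

definition wiener :: "'a pair_pre_digraph \<Rightarrow> nat" where
  "wiener G = (\<Sum>e \<in> {e. e \<subseteq> pverts G \<and> card e = 2}. on_pair (gdist G) e)"

definition n_closer :: "'a pair_pre_digraph \<Rightarrow> 'a \<Rightarrow> 'a \<Rightarrow> nat" where
  "n_closer G a b = card {w \<in> pverts G. gdist G w a < gdist G w b}"

definition szeged :: "'a pair_pre_digraph \<Rightarrow> nat" where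
  "szeged G = (\<Sum>e \<in> edges G. on_pair (\<lambda>a b. n_closer G a b * n_closer G b a) e)"

definition eta :: "'a pair_pre_digraph \<Rightarrow> int" where
  "eta G = int (szeged G) - int (wiener G)"

lemma on_pair_eq:
  assumes "f a b = f b a"
  shows "on_pair f {a, b} = f a b"
  unfolding on_pair_def using assms by (intro the_equality) (auto simp: doubleton_eq_iff)

lemma (in pair_graph) gdist_commute: "gdist G a b = gdist G b a"
proof -
  have rev: "\<exists>q. apath v q u \<and> length q = length p" if "apath u p v" for u v p
  proof -
    have "length (rev_path p) = length p"
      by (induct p) auto
    moreover have "apath v (rev_path p) u"
      using that awalk_verts_rev_path[of u p v] awalk_rev_path'[of u p v]
      by (simp add: apath_def)
    ultimately show ?thesis by blast
  qed
  have "(\<exists>p. apath a p b \<and> length p = k) \<longleftrightarrow> (\<exists>p. apath b p a \<and> length p = k)" for k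
    using rev by metis
  then show ?thesis
    unfolding gdist_def by presburger
qed

lemma (in pair_graph) on_pair_gdist: "on_pair (gdist G) {a, b} = gdist G a b"
  by (intro on_pair_eq gdist_commute)

lemma on_pair_szeged:
  "on_pair (\<lambda>a b. n_closer G a b * n_closer G b a) {a, b} = n_closer G a b * n_closer G b a"
  by (intro on_pair_eq mult.commute)

end

theory Submission
  imports Defs
begin

text \<open>
  An edge \<open>ab\<close> is good for a pair \<open>x, y\<close> if \<open>a\<close> is nearer than \<open>b\<close> to one of them and \<open>b\<close> nearer than
  \<open>a\<close> to the other. The Szeged index counts pairs with a good edge, and all \<open>d(x, y)\<close> edges of a
  geodesic are good, so \<open>\<eta>\<close> is the sum over all pairs of the excess \<open>c(x, y) \<ge> 0\<close> of the number of good
  edges over \<open>d(x, y)\<close>. We grow a set \<open>S\<close> of vertices inducing a 2-connected graph while keeping the sum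
  of \<open>c\<close> over the pairs in \<open>S\<close> at least \<open>2|S| - 6\<close>.

  If \<open>v \<notin> S\<close> has two neighbours in \<open>S\<close> but is not adjacent to all of \<open>S\<close>, then the sum of \<open>c(v, y)\<close>
  over \<open>y \<in> S\<close> is at least 2: two first steps of geodesics from \<open>v\<close> to the same \<open>y\<close>, or different
  first steps to adjacent \<open>y, y'\<close>, each yield 2, and otherwise \<open>S\<close> would have a cut vertex. If no such
  \<open>v\<close> exists, the distances within a shortest ear on \<open>S\<close> are those on an arc of a cycle, and
  good edges on the ear yield 2 for every new vertex. The start is either two non-adjacent vertices with all
  their common neighbours, of which there are at least two, or else the cycle formed by a shortest ear
  on a maximal clique. Both contain a non-adjacent pair together with all its common neighbours,
  so that no later vertex is adjacent to all of \<open>S\<close>.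
\<close>

section \<open>Good edges and excess\<close>

text \<open>The last axiom makes \<open>d\<close> the path metric of the graph formed by the pairs
  at distance 1.\<close>

locale graph_metric =
  fixes V :: "'a set" and d :: "'a \<Rightarrow> 'a \<Rightarrow> nat"
  assumes finite_V: "finite V"
    and dist_eq_0_iff: "x \<in> V \<Longrightarrow> y \<in> V \<Longrightarrow> d x y = 0 \<longleftrightarrow> x = y"
    and dist_sym: "x \<in> V \<Longrightarrow> y \<in> V \<Longrightarrow> d x y = d y x"
    and triangle: "x \<in> V \<Longrightarrow> y \<in> V \<Longrightarrow> z \<in> V \<Longrightarrow> d x z \<le> d x y + d y z"
    and dist_step: "x \<in> V \<Longrightarrow> y \<in> V \<Longrightarrow> x \<noteq> y \<Longrightarrow> \<exists>g \<in> V. d x g = 1 \<and> Suc (d g y) = d x y"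
begin

definition adj :: "'a \<Rightarrow> 'a \<Rightarrow> bool" where
  "adj x y \<longleftrightarrow> x \<in> V \<and> y \<in> V \<and> d x y = 1"

text \<open>Each good edge is listed once, oriented so that its first end is the one nearer to
  \<open>x\<close>; for \<open>y, x\<close> the same edges appear reversed.\<close>

definition good :: "'a \<Rightarrow> 'a \<Rightarrow> ('a \<times> 'a) set" where
  "good x y = {(a, b). adj a b \<and> d x a < d x b \<and> d y b < d y a}"

text \<open>The subtraction does not truncate: see \<open>dist_le_card_good\<close>.\<close>

definition excess :: "'a \<Rightarrow> 'a \<Rightarrow> nat" where
  "excess x y = card (good x y) - d x y"

definition gates :: "'a \<Rightarrow> 'a \<Rightarrow> 'a set" where
  "gates v y = {g. adj v g \<and> Suc (d g y) = d v y}"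

definition conn :: "'a set \<Rightarrow> bool" where
  "conn S \<longleftrightarrow> (\<forall>x \<in> S. \<forall>y \<in> S. (x, y) \<in> {(u, w). u \<in> S \<and> w \<in> S \<and> adj u w}\<^sup>*)"

text \<open>No size is demanded, so a single edge counts; a shortest ear closes such an edge to a
  cycle.\<close>

definition biconn :: "'a set \<Rightarrow> bool" where
  "biconn S \<longleftrightarrow> conn S \<and> (\<forall>z. conn (S - {z}))"

lemma dist_refl [simp]: "x \<in> V \<Longrightarrow> d x x = 0"
  by (simp add: dist_eq_0_iff)

lemma adj_sym: "adj x y \<Longrightarrow> adj y x"
  by (auto simp: adj_def dist_sym)

lemma adj_irrefl: "adj x y \<Longrightarrow> x \<noteq> y"
  by (auto simp: adj_def)

lemma adjD: "adj x y \<Longrightarrow> x \<in> V" "adj x y \<Longrightarrow> y \<in> V" "adj x y \<Longrightarrow> d x y = 1" "adj x y \<Longrightarrow> d y x = 1"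
  by (auto simp: adj_def dist_sym)

lemma dist_ge_2: "x \<in> V \<Longrightarrow> y \<in> V \<Longrightarrow> x \<noteq> y \<Longrightarrow> \<not> adj x y \<Longrightarrow> 2 \<le> d x y"
  using dist_eq_0_iff[of x y] by (simp add: adj_def)

lemma adj_dist_le:
  assumes "adj a b" "x \<in> V"
  shows "d x b \<le> Suc (d x a)" "d x a \<le> Suc (d x b)"
    and "d b x \<le> Suc (d a x)" "d a x \<le> Suc (d b x)"
  using triangle[of x a b] triangle[of x b a] triangle[of b a x] triangle[of a b x]
    adjD[OF assms(1)] assms(2) by auto

lemma finite_good: "finite (good x y)"
proof (rule finite_subset)
  show "good x y \<subseteq> V \<times> V" by (auto simp: good_def adj_def)
qed (simp add: finite_V)

lemma good_swap: "good y x = (\<lambda>(a, b). (b, a)) ` good x y"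
  by (auto simp: good_def image_iff adj_sym)

lemma excess_sym: "x \<in> V \<Longrightarrow> y \<in> V \<Longrightarrow> excess x y = excess y x"
  unfolding excess_def good_swap[of y x]
  by (subst card_image) (auto simp: inj_on_def dist_sym)

lemma excess_refl [simp]: "x \<in> V \<Longrightarrow> excess x x = 0"
proof -
  have "good x x = {}" by (auto simp: good_def)
  then show "excess x x = 0" by (simp add: excess_def)
qed

lemma gates_nonempty: "v \<in> V \<Longrightarrow> y \<in> V \<Longrightarrow> v \<noteq> y \<Longrightarrow> gates v y \<noteq> {}"
  using dist_step[of v y] by (auto simp: gates_def adj_def)

lemma gates_adj: "adj v y \<Longrightarrow> gates v y = {y}"
  by (auto simp: gates_def adj_def dist_eq_0_iff)

lemma geodesic_point:
  assumes "x \<in> V" "y \<in> V" "k \<le> d x y"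
  shows "\<exists>w \<in> V. d x w = k \<and> d w y = d x y - k"
  using assms(3)
proof (induction k)
  case 0
  then show ?case using assms by (intro bexI[of _ x]) auto
next
  case (Suc k)
  then obtain w where w: "w \<in> V" "d x w = k" "d w y = d x y - k" by auto
  with Suc.prems assms have "w \<noteq> y" by auto
  then obtain g where g: "g \<in> V" "d w g = 1" "Suc (d g y) = d w y"
    using dist_step w(1) assms(2) by blast
  have "d x g = Suc k"
    using triangle[of x w g] triangle[of x g y] w g assms Suc.prems by auto
  with g w show ?case by (intro bexI[of _ g]) auto
qed

section \<open>Lower bounds for the excess\<close>

lemma geodesic_arc:
  assumes "x \<in> V" "y \<in> V" "k < d x y"
  shows "\<exists>a b. (a, b) \<in> good x y \<and> d x a = k \<and> d x a + 1 + d b y = d x y"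
proof -
  obtain a where a: "a \<in> V" "d x a = k" "d a y = d x y - k"
    using geodesic_point assms by (meson less_imp_le)
  with assms have "a \<noteq> y" by auto
  then obtain b where b: "b \<in> V" "d a b = 1" "Suc (d b y) = d a y"
    using dist_step a(1) assms(2) by blast
  have "d x b = Suc k"
    using triangle[of x a b] triangle[of x b y] a b assms by auto
  then have "(a, b) \<in> good x y"
    using a b assms by (auto simp: good_def adj_def dist_sym[of y])
  then show ?thesis using a b assms by (intro exI[of _ a] exI[of _ b]) auto
qed

text \<open>Arcs that start at different distances from \<open>x\<close> are different. One arc
  outside \<open>X\<close> for every level below \<open>d x y\<close> already accounts for
  \<open>d x y\<close> members, and \<open>X\<close> comes on top.\<close>

lemma card_good_ge:
  assumes "x \<in> V" "y \<in> V" "X \<subseteq> good x y"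
    and "\<And>k. k < d x y \<Longrightarrow> \<exists>a b. (a, b) \<in> good x y - X \<and> d x a = k"
  shows "d x y + card X \<le> card (good x y)"
proof -
  have "{..<d x y} \<subseteq> (\<lambda>(a, b). d x a) ` (good x y - X)"
    using assms(4) by force
  then have "d x y \<le> card (good x y - X)"
    using surj_card_le[of "good x y - X" "{..<d x y}"] finite_good by auto
  then show ?thesis
    using assms(3) finite_good card_mono[OF finite_good assms(3)]
    by (simp add: card_Diff_subset finite_subset)
qed

text \<open>A geodesic supplies at every level an arc with \<open>d x a + 1 + d b y = d x y\<close>;
  an arc for which this sum is larger cannot be among them.\<close>

lemma excess_ge_card:
  assumes "x \<in> V" "y \<in> V" "X \<subseteq> good x y"
    and "\<And>a b. (a, b) \<in> X \<Longrightarrow> d x y < d x a + 1 + d b y"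
  shows "card X \<le> excess x y"
proof -
  have "d x y + card X \<le> card (good x y)"
  proof (rule card_good_ge[OF assms(1-3)])
    fix k assume "k < d x y"
    then obtain a b where "(a, b) \<in> good x y" "d x a = k" "d x a + 1 + d b y = d x y"
      using geodesic_arc assms by blast
    with assms(4) show "\<exists>a b. (a, b) \<in> good x y - X \<and> d x a = k" by fastforce
  qed
  then show ?thesis by (simp add: excess_def)
qed

lemma dist_le_card_good: "x \<in> V \<Longrightarrow> y \<in> V \<Longrightarrow> d x y \<le> card (good x y)"
  using card_good_ge[of x y "{}"] geodesic_arc[of x y] by fastforce

lemma excess_ge_1:
  assumes "x \<in> V" "y \<in> V" "adj a b" "d x a < d x b" "d y b < d y a" "d x y < d x a + 1 + d b y"
  shows "1 \<le> excess x y"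
  using excess_ge_card[of x y "{(a, b)}"] assms by (auto simp: good_def)

lemma excess_ge_2_two_gates:
  assumes "v \<in> V" "y \<in> V" "2 \<le> d v y" "g \<in> gates v y" "g' \<in> gates v y" "g \<noteq> g'"
  shows "2 \<le> excess v y"
proof -
  have *: "\<exists>h. adj g h \<and> (v, g) \<in> good v y \<and> (g, h) \<in> good v y \<and> d v g = 1"
    if g: "g \<in> gates v y" for g
  proof -
    have g: "adj v g" "Suc (d g y) = d v y" using that by (auto simp: gates_def)
    then have "g \<noteq> y" "g \<in> V" using assms by (auto simp: adj_def)
    then obtain h where h: "h \<in> V" "d g h = 1" "Suc (d h y) = d g y"
      using dist_step assms by blast
    have "d v h = 2" using triangle[of v g h] triangle[of v h y] g h assms by (auto simp: adj_def)
    with g h assms show ?thesis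
      by (intro exI[of _ h]) (auto simp: good_def adj_def dist_sym[of y])
  qed
  obtain h where h: "adj g h" "(v, g) \<in> good v y" "(g, h) \<in> good v y" "d v g = 1"
    using * assms by blast
  obtain h' where h': "adj g' h'" "(v, g') \<in> good v y" "(g', h') \<in> good v y" "d v g' = 1"
    using * assms by blast
  \<comment> \<open>Levels 0 and 1 are served by the geodesic through \<open>g\<close>, so the first
    two arcs through \<open>g'\<close> are surplus; arcs at higher levels cannot be in
    \<open>X\<close>.\<close>
  define X where "X = {(v, g'), (g', h')}"
  have "d v y + card X \<le> card (good v y)"
  proof (rule card_good_ge)
    fix k assume k: "k < d v y"
    show "\<exists>a b. (a, b) \<in> good v y - X \<and> d v a = k"
    proof (cases "k < 2")
      case True
      then consider "k = 0" | "k = 1" by linarith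
      then show ?thesis
      proof cases
        case 1
        then show ?thesis using h h' assms by (intro exI[of _ v] exI[of _ g]) (auto simp: X_def)
      next
        case 2
        then show ?thesis using h h' assms by (intro exI[of _ g] exI[of _ h]) (auto simp: X_def)
      qed
    next
      case False
      obtain a b where "(a, b) \<in> good v y" "d v a = k" using geodesic_arc k assms by blast
      with False h' assms show ?thesis by (intro exI[of _ a] exI[of _ b]) (auto simp: X_def)
    qed
  qed (use assms h' in \<open>auto simp: X_def\<close>)
  moreover have "card X = 2"
    using h' assms adj_irrefl[of g' h'] by (auto simp: X_def good_def adj_def)
  ultimately show ?thesis by (simp add: excess_def)
qed

section \<open>First steps of geodesics from a vertex to a set\<close>

lemma gates_mono:
  assumes "v \<in> V" "adj y y'" "d v y < d v y'"
  shows "gates v y \<subseteq> gates v y'"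
proof
  fix g assume "g \<in> gates v y"
  then have g: "adj v g" "g \<in> V" "Suc (d g y) = d v y" by (auto simp: gates_def adj_def)
  have "d v y' \<le> Suc (d g y')" using adj_dist_le(4)[OF g(1)] assms(2) by (auto simp: adj_def)
  moreover have "d g y' \<le> Suc (d g y)" using adj_dist_le(1)[OF assms(2) g(2)] .
  ultimately show "g \<in> gates v y'" using g assms by (auto simp: gates_def)
qed

text \<open>The surplus edge joins \<open>y'\<close> to its predecessor \<open>p\<close> on a
  geodesic through \<open>g'\<close>. It is good for \<open>v, y\<close> because \<open>y\<close>
  has distance at least 2 from \<open>p\<close>; otherwise \<open>g'\<close> would start a geodesic
  to \<open>y\<close> as well.\<close>

lemma excess_ge_1_gate:
  assumes "v \<in> V" "adj y y'" "d v y = d v y'" "2 \<le> d v y" "g' \<in> gates v y'" "g' \<notin> gates v y"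
  shows "1 \<le> excess v y"
proof -
  have V: "y \<in> V" "y' \<in> V" "g' \<in> V" and g: "adj v g'" "Suc (d g' y') = d v y'"
    using assms by (auto simp: gates_def adj_def)
  have "d v y \<le> d g' y"
    using adj_dist_le(4)[OF g(1) V(1)] assms(6) g by (auto simp: gates_def)
  have "g' \<noteq> y'" using g assms V by auto
  then obtain p where p: "p \<in> V" "d y' p = 1" "Suc (d p g') = d y' g'"
    using dist_step V by blast
  have "d v p < d v y'"
    using triangle[of v g' p] g p V assms by (auto simp: adj_def dist_sym)
  moreover have "1 < d y p"
  proof -
    have "d g' y \<le> d p g' + d y p"
      using triangle[of g' p y] p(1) V dist_sym[of g' p] dist_sym[of p y] by simp
    moreover have "d y' g' = d g' y'" using V dist_sym by blast
    ultimately show ?thesis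
      using \<open>d v y \<le> d g' y\<close> p(3) g(2) assms(3) by linarith
  qed
  moreover have "d v y' \<le> Suc (d v p)"
    using triangle[of v p y'] p V assms by (auto simp: dist_sym)
  ultimately show ?thesis
    using excess_ge_1[of v y p y'] p V assms(1-3)
    by (auto simp: adj_def dist_sym)
qed

lemma gates_singleton:
  assumes "v \<in> V" "S \<subseteq> V" "v \<notin> S" "(\<Sum>y\<in>S. excess v y) \<le> 1" "z \<in> S"
  shows "\<exists>g. gates v z = {g}"
proof (cases "adj v z")
  case True
  then show ?thesis by (simp add: gates_adj)
next
  case False
  have fin: "finite S" using assms(2) finite_V finite_subset by blast
  have z: "z \<in> V" "v \<noteq> z" using assms by auto
  with False have "2 \<le> d v z"
    using dist_ge_2 assms(1) by simp
  moreover have "excess v z \<le> 1"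
    using member_le_sum[OF assms(5), of "excess v"] fin assms(4) by auto
  ultimately have "g = g'" if "g \<in> gates v z" "g' \<in> gates v z" for g g'
    using excess_ge_2_two_gates[of v z g g'] z that assms(1) by fastforce
  with gates_nonempty[of v z] z assms(1) show ?thesis by blast
qed

text \<open>By \<open>gates_mono\<close>, different first steps force \<open>d v y = d v y'\<close>;
  then \<open>excess_ge_1_gate\<close> applies in both directions, and the excesses of
  \<open>y\<close> and \<open>y'\<close> add up to 2. Two neighbours of \<open>v\<close> are exempt,
  each being its own only gate.\<close>

lemma gates_eq_along_edge:
  assumes "v \<in> V" "S \<subseteq> V" "v \<notin> S" "(\<Sum>y\<in>S. excess v y) \<le> 1"
    and "y \<in> S" "y' \<in> S" "adj y y'" "\<not> (adj v y \<and> adj v y')"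
  shows "gates v y = gates v y'"
proof (rule ccontr)
  assume ne: "gates v y \<noteq> gates v y'"
  have fin: "finite S" using assms(2) finite_V finite_subset by blast
  obtain g g' where g: "gates v y = {g}" "gates v y' = {g'}" 
    using gates_singleton[OF assms(1-5)] gates_singleton[OF assms(1-4,6)] by blast
  with ne have "g \<noteq> g'" by auto
  have "\<not> d v y < d v y'"
    using gates_mono[OF assms(1,7)] g \<open>g \<noteq> g'\<close> by auto
  moreover have "\<not> d v y' < d v y"
    using gates_mono[OF assms(1) adj_sym[OF assms(7)]] g \<open>g \<noteq> g'\<close> by auto
  ultimately have eq: "d v y = d v y'" by simp
  have "y \<in> V" "y' \<in> V" "v \<noteq> y" "v \<noteq> y'" using assms by auto
  then have "2 \<le> d v y"
    using dist_ge_2[of v y] dist_ge_2[of v y'] eq assms(1,8) by metis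
  then have "1 \<le> excess v y" "1 \<le> excess v y'"
    using excess_ge_1_gate[OF assms(1,7) eq, of g']
      excess_ge_1_gate[OF assms(1) adj_sym[OF assms(7)] eq[symmetric], of g] eq g \<open>g \<noteq> g'\<close>
    by auto
  moreover have "(\<Sum>z\<in>{y, y'}. excess v z) \<le> (\<Sum>z\<in>S. excess v z)"
    using fin assms(5,6) by (intro sum_mono2) auto
  ultimately show False using assms(4) adj_irrefl[OF assms(7)] by simp
qed

lemma conn_induct [consumes 3, case_names base step]:
  assumes "conn S" "x \<in> S" "y \<in> S"
    and "P x"
    and "\<And>u w. u \<in> S \<Longrightarrow> w \<in> S \<Longrightarrow> adj u w \<Longrightarrow> P u \<Longrightarrow> P w"
  shows "P y"
proof -
  have "(x, y) \<in> {(u, w). u \<in> S \<and> w \<in> S \<and> adj u w}\<^sup>*"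
    using assms(1-3) by (auto simp: conn_def)
  then show ?thesis
    by (induction rule: rtrancl_induct) (use assms(4,5) in auto)
qed

text \<open>If the sum were at most 1, all of \<open>S\<close> not adjacent to \<open>v\<close> would be reached from \<open>v\<close> through
  the same neighbour \<open>g\<close>, which would be a cut vertex of \<open>S\<close>.\<close>

lemma sum_excess_ge_2_biconn:
  assumes "biconn S" "S \<subseteq> V" "v \<in> V - S" "y \<in> S" "\<not> adj v y"
    and "b \<in> S" "b' \<in> S" "b \<noteq> b'" "adj v b" "adj v b'"
  shows "2 \<le> (\<Sum>y\<in>S. excess v y)"
proof (rule ccontr)
  assume "\<not> ?thesis"
  then have le: "(\<Sum>y\<in>S. excess v y) \<le> 1" by simp
  obtain g where g: "g \<in> gates v y" using gates_nonempty[of v y] assms by auto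
  then have "adj v g" by (auto simp: gates_def)
  then have "y \<noteq> g" using assms(5) by auto
  obtain c where c: "c \<in> S - {g}" "adj v c" using assms by blast
  have "conn (S - {g})" "y \<in> S - {g}" using assms(1,4) \<open>y \<noteq> g\<close> by (auto simp: biconn_def)
  from this c(1) have "\<not> adj v c \<and> gates v c = gates v y"
  proof (induction rule: conn_induct[where x = y and y = c])
    case base
    then show ?case using assms(5) by simp
  next
    case (step u w)
    then have "gates v u = gates v w"
      using gates_eq_along_edge[of v S u w] assms(2,3) le by auto
    \<comment> \<open>A neighbour \<open>w\<close> of \<open>v\<close> would be its own only gate,
      but \<open>g\<close> is a gate for \<open>w\<close> too, and \<open>g\<close> has been
      removed.\<close>
    moreover have "\<not> adj v w"
      using gates_adj[of v w] step g calculation by auto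
    ultimately show ?case using step by simp
  qed
  with c show False by simp
qed

text \<open>At most one neighbour of \<open>v\<close> lies in \<open>S\<close>, so the exemption in
  \<open>gates_eq_along_edge\<close> never occurs. A sum below 2 would make the first step the same
  throughout the connected set.\<close>

lemma sum_excess_ge_2_gates:
  assumes "conn S" "S \<subseteq> V" "v \<in> V - S" "\<And>z z'. z \<in> S \<Longrightarrow> z' \<in> S \<Longrightarrow> adj v z \<Longrightarrow> adj v z' \<Longrightarrow> z = z'"
    and "y \<in> S" "y' \<in> S" "g \<in> gates v y" "g' \<in> gates v y'" "g \<noteq> g'"
  shows "2 \<le> (\<Sum>y\<in>S. excess v y)"
proof (rule ccontr)
  assume "\<not> ?thesis"
  then have le: "(\<Sum>y\<in>S. excess v y) \<le> 1" by simp
  from assms(1,5,6) have "gates v y' = gates v y"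
  proof (induction rule: conn_induct[where x = y and y = y'])
    case (step u w)
    then have "\<not> (adj v u \<and> adj v w)" using assms(4) adj_irrefl by blast
    then show ?case
      using step gates_eq_along_edge[of v S u w] assms(2,3) le by auto
  qed simp
  moreover obtain h where "gates v y = {h}"
    using gates_singleton[of v S y] assms le by auto
  ultimately show False using assms(7-9) by auto
qed

section \<open>Shortest ears\<close>

text \<open>\<open>exits S u z r\<close>: some walk of length \<open>r\<close> from \<open>u\<close> meets \<open>S\<close> for the first time at its end \<open>z\<close>.\<close>

inductive exits :: "'a set \<Rightarrow> 'a \<Rightarrow> 'a \<Rightarrow> nat \<Rightarrow> bool" for S where
  exits_stop: "z \<in> S \<Longrightarrow> exits S z z 0"
| exits_step: "u \<notin> S \<Longrightarrow> adj u u' \<Longrightarrow> exits S u' z r \<Longrightarrow> exits S u z (Suc r)"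

text \<open>Inner vertices may repeat, and \<open>l = 1\<close> is an edge inside \<open>S\<close>.
  For a shortest ear, distinctness follows by \<open>geodesic_arc_inj\<close>.\<close>

definition ear :: "'a set \<Rightarrow> nat \<Rightarrow> (nat \<Rightarrow> 'a) \<Rightarrow> bool" where
  "ear S l q \<longleftrightarrow> q 0 \<in> S \<and> q l \<in> S \<and> q 0 \<noteq> q l \<and>
     (\<forall>i. 0 < i \<and> i < l \<longrightarrow> q i \<in> V - S) \<and> (\<forall>i<l. adj (q i) (q (Suc i)))"

text \<open>Minimality is required against all pairs of walks from one vertex to different first
  vertices in \<open>S\<close>, because geodesics yield such walks directly. The bound
  \<open>2 \<le> l\<close> excludes an edge inside \<open>S\<close>.\<close>

definition shortest_ear :: "'a set \<Rightarrow> nat \<Rightarrow> (nat \<Rightarrow> 'a) \<Rightarrow> bool" where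
  "shortest_ear S l q \<longleftrightarrow> ear S l q \<and> 2 \<le> l \<and>
     (\<forall>u z z' r r'. exits S u z r \<and> exits S u z' r' \<and> z \<noteq> z' \<longrightarrow> l \<le> r + r')"

lemma exits_end: "exits S u z r \<Longrightarrow> z \<in> S"
  by (induction rule: exits.induct)

lemma exits_inside: "exits S u z r \<Longrightarrow> u \<in> S \<Longrightarrow> z = u \<and> r = 0"
  by (cases rule: exits.cases) auto

lemma exits_0: "exits S u z 0 \<Longrightarrow> z = u"
  by (cases rule: exits.cases) auto

text \<open>Follow a geodesic from \<open>u\<close> to \<open>w\<close>. Either it avoids
  \<open>S\<close> before \<open>w\<close>, and every exit from \<open>w\<close> can be prolonged
  backwards, or it is cut at its first vertex \<open>z\<close> in \<open>S\<close>, which leaves a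
  geodesic from \<open>z\<close> to \<open>w\<close>.\<close>

lemma exits_or_through:
  assumes "S \<subseteq> V" "u \<in> V" "w \<in> V"
  shows "(\<forall>z r. exits S w z r \<longrightarrow> exits S u z (d u w + r)) \<or>
    (\<exists>z r. exits S u z r \<and> d u w = r + d z w)"
  using assms(2)
proof (induction "d u w" arbitrary: u)
  case 0
  then have "u = w" using assms dist_eq_0_iff by metis
  with assms show ?case by simp
next
  case (Suc n)
  show ?case
  proof (cases "u \<in> S")
    case True
    then have "exits S u u 0 \<and> d u w = 0 + d u w" by (auto intro: exits_stop)
    then show ?thesis by blast
  next
    case False
    have "u \<noteq> w" using Suc assms by auto
    then obtain g where g: "g \<in> V" "d u g = 1" "Suc (d g w) = d u w"
      using dist_step Suc.prems assms by blast
    have *: "exits S u z (Suc r)" if "exits S g z r" for z r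
      using False g Suc.prems that by (auto intro!: exits_step simp: adj_def)
    have "n = d g w" using g Suc by simp
    from Suc.hyps(1)[OF this g(1)] show ?thesis
    proof
      assume "\<forall>z r. exits S w z r \<longrightarrow> exits S g z (d g w + r)"
      then have "\<forall>z r. exits S w z r \<longrightarrow> exits S u z (Suc (d g w + r))" using * by blast
      then show ?thesis by (simp add: g(3)[symmetric])
    next
      assume "\<exists>z r. exits S g z r \<and> d g w = r + d z w"
      then obtain z r where "exits S g z r" "d g w = r + d z w" by blast
      with * have "exits S u z (Suc r) \<and> d u w = Suc r + d z w" by (simp add: g(3)[symmetric])
      then show ?thesis by blast
    qed
  qed
qed

lemma exits_through:
  assumes "S \<subseteq> V" "u \<in> V" "w \<in> S"
  obtains z r where "exits S u z r" "d u w = r + d z w"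
proof -
  have "w \<in> V" using assms by auto
  from exits_or_through[OF assms(1,2) this] show ?thesis
  proof
    assume "\<forall>z r. exits S w z r \<longrightarrow> exits S u z (d u w + r)"
    then have "exits S u w (d u w)" using exits_stop[OF assms(3)] by fastforce
    with that[of w "d u w"] \<open>w \<in> V\<close> show ?thesis by simp
  qed (use that in blast)
qed

lemma ear_rev:
  assumes "ear S l q"
  shows "ear S l (\<lambda>i. q (l - i))"
proof -
  have "adj (q (l - i)) (q (l - Suc i))" if "i < l" for i
  proof -
    have "adj (q (l - Suc i)) (q (Suc (l - Suc i)))" using assms that by (simp add: ear_def)
    with that show ?thesis by (simp add: adj_sym Suc_diff_Suc)
  qed
  with assms show ?thesis by (auto simp: ear_def)
qed

lemma shortest_ear_rev: "shortest_ear S l q \<Longrightarrow> shortest_ear S l (\<lambda>i. q (l - i))"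
  unfolding shortest_ear_def using ear_rev by blast

lemma ear_exits_left:
  assumes "ear S l q"
  shows "i < l \<Longrightarrow> exits S (q i) (q 0) i"
proof (induction i)
  case 0
  then show ?case using assms by (auto simp: ear_def intro: exits_stop)
next
  case (Suc i)
  then have "q (Suc i) \<notin> S" "adj (q (Suc i)) (q i)" using assms adj_sym by (auto simp: ear_def)
  with Suc show ?case by (auto intro: exits_step)
qed

lemma ear_exits_right:
  assumes "ear S l q" "0 < i" "i \<le> l"
  shows "exits S (q i) (q l) (l - i)"
  using ear_exits_left[OF ear_rev[OF assms(1)], of "l - i"] assms(2,3) by simp

lemma ear_V: "ear S l q \<Longrightarrow> S \<subseteq> V \<Longrightarrow> i \<le> l \<Longrightarrow> q i \<in> V"
  unfolding ear_def by (cases "i = 0"; cases "i = l") auto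

lemma exits_path:
  assumes "exits S u z r"
  shows "\<exists>p. p 0 = u \<and> p r = z \<and> (\<forall>i<r. p i \<in> V - S \<and> adj (p i) (p (Suc i)))"
  using assms
proof (induction rule: exits.induct)
  case (exits_stop z)
  show ?case by (intro exI[of _ "\<lambda>_. z"]) auto
next
  case (exits_step u u' z r)
  then obtain p where p: "p 0 = u'" "p r = z" "\<forall>i<r. p i \<in> V - S \<and> adj (p i) (p (Suc i))" by blast
  have "adj (case_nat u p i) (case_nat u p (Suc i)) \<and> case_nat u p i \<in> V - S" if "i < Suc r" for i
    using that p exits_step(1,2) by (cases i) (auto simp: adj_def)
  with p show ?case by (intro exI[of _ "case_nat u p"]) auto
qed

lemma shortest_ear_exists:
  assumes "S \<subseteq> V" "v \<in> V - S" "a \<in> S" "b \<in> S" "a \<noteq> b" "biconn V"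
  shows "\<exists>l q. shortest_ear S l q"
proof -
  define P where "P = (\<lambda>n. \<exists>u z z' r r'. exits S u z r \<and> exits S u z' r' \<and> z \<noteq> z' \<and> n = r + r')"
  obtain z r where z: "exits S v z r" using exits_through[of S v a] assms by blast
  obtain c where c: "c \<in> S - {z}" using assms by blast
  have "z \<in> S" using exits_end z by blast
  have "conn (V - {z})" "c \<in> V - {z}" "v \<in> V - {z}"
    using assms \<open>z \<in> S\<close> c by (auto simp: biconn_def)
  \<comment> \<open>Induction along a path from \<open>c\<close> to \<open>v\<close> that avoids
    \<open>z\<close>: a vertex of the path outside \<open>S\<close> uses the exit of its
    predecessor, a vertex in \<open>S\<close> exits at itself.\<close>
  then have "\<exists>z' r'. exits S v z' r' \<and> z' \<noteq> z"
  proof (induction rule: conn_induct)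
    case base
    then show ?case using c by (auto intro!: exits_stop)
  next
    case (step u w)
    show ?case
    proof (cases "w \<in> S")
      case True
      then show ?thesis using step by (auto intro: exits_stop)
    next
      case False
      then show ?thesis using step exits_step adj_sym by blast
    qed
  qed
  with z have "\<exists>n. P n" unfolding P_def by blast
  then have "P (LEAST n. P n)" by (rule LeastI_ex)
  then obtain u a b r r' where u: "exits S u a r" "exits S u b r'" "a \<noteq> b" "(LEAST n. P n) = r + r'"
    unfolding P_def by blast
  have min: "r + r' \<le> s + s'" if "exits S w z s" "exits S w z' s'" "z \<noteq> z'" for w z z' s s'
    using Least_le[of P "s + s'"] that u(4) unfolding P_def by metis
  have "u \<notin> S" using u exits_inside by blast
  have pos: "0 < r" "0 < r'" using u \<open>u \<notin> S\<close> exits_0 exits_end by (metis gr0I)+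
  obtain p where p: "p 0 = u" "p r = a" "\<forall>i<r. p i \<in> V - S \<and> adj (p i) (p (Suc i))"
    using exits_path u by blast
  obtain p' where p': "p' 0 = u" "p' r' = b" "\<forall>i<r'. p' i \<in> V - S \<and> adj (p' i) (p' (Suc i))"
    using exits_path u by blast
  \<comment> \<open>The ear runs back from \<open>a\<close> to \<open>u\<close> along
    \<open>p\<close> and on to \<open>b\<close> along \<open>p'\<close>.\<close>
  define q where "q i = (if i \<le> r then p (r - i) else p' (i - r))" for i
  have "adj (q i) (q (Suc i))" if "i < r + r'" for i
  proof (cases "i < r")
    case True
    then have "r - Suc i < r" "Suc (r - Suc i) = r - i" by auto
    then have "adj (p (r - Suc i)) (p (r - i))" using p(3) by metis
    with True show ?thesis by (simp add: q_def adj_sym)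
  next
    case False
    then have "q i = p' (i - r)" "q (Suc i) = p' (Suc (i - r))"
      using p(1) p'(1) by (auto simp: q_def Suc_diff_le)
    with p'(3) that False show ?thesis by auto
  qed
  moreover have "q i \<in> V - S" if "0 < i" "i < r + r'" for i
  proof (cases "i \<le> r")
    case True
    then show ?thesis using that p(3) by (auto simp: q_def)
  next
    case False
    then have "i - r < r'" using that by auto
    then show ?thesis using p'(3) False by (auto simp: q_def)
  qed
  moreover have "q 0 = a" "q (r + r') = b" using p p' pos by (auto simp: q_def)
  moreover have "a \<in> S" "b \<in> S" using u exits_end by auto
  ultimately have "ear S (r + r') q" using u(3) unfolding ear_def by auto
  then have "shortest_ear S (r + r') q"
    unfolding shortest_ear_def using min pos by fastforce
  then show ?thesis by blast
qed

text \<open>The distances are those on a cycle of length \<open>l + d (q 0) (q l)\<close> that has \<open>q\<close> as an arc;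
  \<open>V\<close> need not contain an isometric cycle of this kind.\<close>

definition geodesic_arc_of_cycle :: "nat \<Rightarrow> (nat \<Rightarrow> 'a) \<Rightarrow> bool" where
  "geodesic_arc_of_cycle l q \<longleftrightarrow> q 0 \<noteq> q l \<and> (\<forall>i\<le>l. q i \<in> V) \<and> (\<forall>i<l. adj (q i) (q (Suc i))) \<and>
     (\<forall>i j. i \<le> j \<and> j \<le> l \<longrightarrow> d (q i) (q j) = min (j - i) (i + d (q 0) (q l) + (l - j)))"

lemma arc_dist_le:
  assumes "\<And>i. i \<le> l \<Longrightarrow> q i \<in> V" "\<And>i. i < l \<Longrightarrow> adj (q i) (q (Suc i))" "i \<le> j" "j \<le> l"
  shows "d (q i) (q j) \<le> j - i"
  using assms(3,4)
proof (induction j)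
  case 0
  then show ?case using assms(1) by simp
next
  case (Suc j)
  show ?case
  proof (cases "i = Suc j")
    case True
    then show ?thesis using assms(1) Suc by simp
  next
    case False
    then have "d (q i) (q j) \<le> j - i" using Suc by simp
    then show ?thesis using adj_dist_le(1)[of "q j" "q (Suc j)" "q i"] assms(1,2) Suc False
      by (simp add: Suc_diff_le)
  qed
qed

text \<open>The two arcs of the cycle give the upper bound. For the lower bound, a shorter
  connection could be combined with pieces of the ear into two walks that contradict
  minimality.\<close>

lemma shortest_ear_geodesic:
  assumes "shortest_ear S l q" "S \<subseteq> V"
  shows "geodesic_arc_of_cycle l q"
proof -
  have e: "ear S l q" using assms by (simp add: shortest_ear_def)
  have M: "l \<le> r + r'" if "exits S u z r" "exits S u z' r'" "z \<noteq> z'" for u z z' r r'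
    using assms that unfolding shortest_ear_def by blast
  have V: "q i \<in> V" if "i \<le> l" for i using ear_V[OF e assms(2) that] .
  have ab: "q 0 \<in> S" "q l \<in> S" "q 0 \<noteq> q l" and A: "\<And>i. i < l \<Longrightarrow> adj (q i) (q (Suc i))"
    using e by (auto simp: ear_def)
  define e where "e = d (q 0) (q l)"
  have L: "exits S (q i) (q 0) i" if "i < l" for i using ear_exits_left[OF \<open>ear S l q\<close> that] .
  have R: "exits S (q i) (q l) (l - i)" if "0 < i" "i \<le> l" for i
    using ear_exits_right[OF \<open>ear S l q\<close> that] .
  \<comment> \<open>Let \<open>z\<close> be the first vertex in \<open>S\<close> on a geodesic from
    \<open>q j\<close> to \<open>q 0\<close>. If \<open>z\<close> is \<open>q l\<close>, the walk to
    it has length at least \<open>l - j\<close>, and \<open>e\<close> more steps follow. If not,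
    comparison with the exit at \<open>q l\<close> makes the walk to \<open>z\<close> at least
    \<open>j\<close> long.\<close>
  have low0: "min j (l - j + e) \<le> d (q j) (q 0)" if "j \<le> l" "0 < j" for j
  proof -
    obtain z r where z: "exits S (q j) z r" "d (q j) (q 0) = r + d z (q 0)"
      by (rule exits_through[OF assms(2) V[OF \<open>j \<le> l\<close>] ab(1)])
    show ?thesis
    proof (cases "z = q l")
      case True
      have "l - j \<le> r"
      proof (cases "j = l")
        case False
        then show ?thesis using M[OF z(1) L[of j]] True ab that by auto
      qed simp
      then show ?thesis using z True dist_sym[of "q l" "q 0"] V by (simp add: e_def)
    next
      case False
      then have "j \<le> r" using M[OF z(1) R[OF that(2,1)]] that by auto
      then show ?thesis using z by simp
    qed
  qed
  have low: "min (j - i) (i + e + (l - j)) \<le> d (q i) (q j)" if "i < j" "j \<le> l" for i j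
  proof -
    have "q i \<in> V" "q j \<in> V" using V that by auto
    from exits_or_through[OF assms(2) this] show ?thesis
    proof
      \<comment> \<open>The geodesic does not meet \<open>S\<close> before \<open>q j\<close>.
        Continued along the ear it exits at \<open>q l\<close>; compared with the exit of length
        \<open>i\<close> at \<open>q 0\<close>, it has at least \<open>j - i\<close> steps up to
        \<open>q j\<close>.\<close>
      assume *: "\<forall>z r. exits S (q j) z r \<longrightarrow> exits S (q i) z (d (q i) (q j) + r)"
      have "exits S (q j) (q l) (l - j)" using R that by simp
      with * have "exits S (q i) (q l) (d (q i) (q j) + (l - j))" by blast
      from M[OF this L[of i]] that ab show ?thesis by auto
    next
      assume "\<exists>z r. exits S (q i) z r \<and> d (q i) (q j) = r + d z (q j)"
      then obtain z r where z: "exits S (q i) z r" "d (q i) (q j) = r + d z (q j)" by blast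
      \<comment> \<open>An exit at \<open>q 0\<close> takes at least \<open>i\<close> steps and
        leaves the situation of \<open>low0\<close>; an exit elsewhere takes at least
        \<open>l - i\<close> steps.\<close>
      show ?thesis
      proof (cases "z = q 0")
        case True
        have "i \<le> r"
        proof (cases "i = 0")
          case False
          then show ?thesis using M[OF z(1) R[of i]] True ab that by auto
        qed simp
        then show ?thesis using z True low0[of j] dist_sym[of "q 0" "q j"] V that by simp
      next
        case False
        then show ?thesis using M[OF z(1) L[of i]] z that by auto
      qed
    qed
  qed
  have up: "d (q i) (q j) \<le> min (j - i) (i + e + (l - j))" if "i \<le> j" "j \<le> l" for i j
  proof -
    have "d (q i) (q j) \<le> d (q i) (q 0) + d (q 0) (q l) + d (q l) (q j)"
      using triangle[of "q i" "q 0" "q j"] triangle[of "q 0" "q l" "q j"] V that by force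
    moreover have "d (q i) (q 0) \<le> i" "d (q l) (q j) \<le> l - j" "d (q i) (q j) \<le> j - i"
      using arc_dist_le[of l q 0 i] arc_dist_le[of l q j l] arc_dist_le[of l q i j] V A that
        dist_sym[of "q i" "q 0"] dist_sym[of "q l" "q j"] by auto
    ultimately show ?thesis by (simp add: e_def)
  qed
  have "d (q i) (q j) = min (j - i) (i + e + (l - j))" if "i \<le> j" "j \<le> l" for i j
    using up[OF that] low[of i j] that V[of i] by (cases "i = j") auto
  then show ?thesis using ab(3) V A unfolding geodesic_arc_of_cycle_def e_def by blast
qed

lemma geodesic_arcD:
  assumes "geodesic_arc_of_cycle l q"
  shows "\<And>i. i \<le> l \<Longrightarrow> q i \<in> V" "\<And>i. i < l \<Longrightarrow> adj (q i) (q (Suc i))" "0 < d (q 0) (q l)"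
proof -
  show V: "\<And>i. i \<le> l \<Longrightarrow> q i \<in> V" and "\<And>i. i < l \<Longrightarrow> adj (q i) (q (Suc i))"
    using assms unfolding geodesic_arc_of_cycle_def by blast+
  have "q 0 \<noteq> q l" using assms unfolding geodesic_arc_of_cycle_def by blast
  then show "0 < d (q 0) (q l)" using dist_eq_0_iff[of "q 0" "q l"] V[of 0] V[of l] by simp
qed

lemma geodesic_arc_dist:
  assumes "geodesic_arc_of_cycle l q" "i \<le> l" "j \<le> l"
  shows "d (q i) (q j) =
    (if i \<le> j then min (j - i) (i + d (q 0) (q l) + (l - j)) else min (i - j) (j + d (q 0) (q l) + (l - i)))"
proof -
  have le: "d (q i) (q j) = min (j - i) (i + d (q 0) (q l) + (l - j))" if "i \<le> j" "j \<le> l" for i j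
    using assms(1) that unfolding geodesic_arc_of_cycle_def by blast
  show ?thesis
  proof (cases "i \<le> j")
    case True
    then show ?thesis by (simp only: le[OF True assms(3)] if_True)
  next
    case False
    moreover have "d (q i) (q j) = d (q j) (q i)"
      by (rule dist_sym) (use geodesic_arcD(1)[OF assms(1)] assms(2,3) in blast)+
    moreover have "j \<le> i" using False by simp
    ultimately show ?thesis by (simp only: le[OF \<open>j \<le> i\<close> assms(2)] if_False)
  qed
qed

lemma geodesic_arc_inj:
  assumes "geodesic_arc_of_cycle l q"
  shows "inj_on q {..l}"
proof (rule inj_onI)
  fix i j assume ij: "i \<in> {..l}" "j \<in> {..l}" and "q i = q j"
  then have "d (q i) (q j) = 0" using geodesic_arcD(1)[OF assms, of j] by simp
  moreover have "d (q i) (q j) =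
    (if i \<le> j then min (j - i) (i + d (q 0) (q l) + (l - j)) else min (i - j) (j + d (q 0) (q l) + (l - i)))"
    using geodesic_arc_dist[OF assms] ij by simp
  ultimately show "i = j"
    using geodesic_arcD(3)[OF assms] by (simp add: min_def split: if_splits)
qed

section \<open>Excess between vertices of the cycle closed by an ear\<close>

lemma excess_ge_arcs:
  assumes "geodesic_arc_of_cycle l q" "x \<in> V" "y \<in> V" "T \<subseteq> {..<l}"
    and "\<And>t. t \<in> T \<Longrightarrow> d x (q t) < d x (q (Suc t)) \<and> d y (q (Suc t)) < d y (q t) \<and>
      d x y < d x (q t) + 1 + d (q (Suc t)) y"
  shows "card T \<le> excess x y"
proof -
  have "inj_on q T"
    using geodesic_arc_inj[OF assms(1)] by (rule inj_on_subset) (use assms(4) in auto)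
  then have "inj_on (\<lambda>t. (q t, q (Suc t))) T" by (auto simp: inj_on_def)
  then have "card T = card ((\<lambda>t. (q t, q (Suc t))) ` T)" by (simp add: card_image)
  also have "\<dots> \<le> excess x y"
    using assms geodesic_arcD(2)[OF assms(1)]
    by (intro excess_ge_card) (auto simp: good_def)
  finally show ?thesis .
qed

text \<open>Since \<open>2 * i + e < l\<close>, the part of the ear from \<open>q i\<close> to
  \<open>q l\<close> is longer than \<open>d (q i) (q l)\<close>. On the cycle of length
  \<open>l + e\<close>, the last two bounds place the arc at \<open>s\<close> beyond the antipode of
  \<open>q l\<close> and short of that of \<open>q i\<close>, so it leads towards the former and
  away from the latter.\<close>

lemma end_arc:
  assumes "geodesic_arc_of_cycle l q" "d (q 0) (q l) = e"
    and "2 * i + e < l" "i \<le> s" "s < l" "l \<le> 2 * s + e" "2 * s + 1 < 2 * i + l + e"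
  shows "d (q i) (q s) < d (q i) (q (Suc s)) \<and> d (q l) (q (Suc s)) < d (q l) (q s) \<and>
    d (q i) (q l) < d (q i) (q s) + 1 + d (q (Suc s)) (q l)"
proof -
  have D: "d (q i) (q j) =
    (if i \<le> j then min (j - i) (i + e + (l - j)) else min (i - j) (j + e + (l - i)))"
    if "i \<le> l" "j \<le> l" for i j
    using geodesic_arc_dist[OF assms(1) that] assms(2) by simp
  have "d (q i) (q s) = s - i" using D[of i s] assms(3-) by simp
  moreover have "s - i < d (q i) (q (Suc s))" using D[of i "Suc s"] assms(3-) by simp
  moreover have "d (q (Suc s)) (q l) = l - Suc s" using D[of "Suc s" l] assms(3-) by simp
  moreover have "d (q l) (q (Suc s)) = d (q (Suc s)) (q l)"
    by (rule dist_sym) (use geodesic_arcD(1)[OF assms(1)] assms(5) in auto)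
  moreover have "d (q i) (q l) = i + e" using D[of i l] assms(3-) by simp
  moreover have "l - Suc s < d (q l) (q s)" using D[of l s] assms(3-) by simp
  ultimately show ?thesis using assms(3-) by simp
qed

lemma excess_end_ge_1:
  assumes "geodesic_arc_of_cycle l q" "1 \<le> i" "2 * i + d (q 0) (q l) < l"
  shows "1 \<le> excess (q i) (q l)"
proof -
  define e where "e = d (q 0) (q l)"
  have e: "1 \<le> e" "2 * i + e < l" using geodesic_arcD(3)[OF assms(1)] assms by (auto simp: e_def)
  define h where "h = (l + e) div 2"
  have h: "2 * h \<le> l + e" "l + e \<le> 2 * h + 1" by (auto simp: h_def)
  \<comment> \<open>\<open>i + h - 1\<close> is the largest index that \<open>end_arc\<close>
    allows.\<close>
  have "card {i + h - 1} \<le> excess (q i) (q l)"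
  proof (intro excess_ge_arcs[OF assms(1)])
    fix s assume "s \<in> {i + h - 1}"
    then show "d (q i) (q s) < d (q i) (q (Suc s)) \<and> d (q l) (q (Suc s)) < d (q l) (q s) \<and>
        d (q i) (q l) < d (q i) (q s) + 1 + d (q (Suc s)) (q l)"
      using h e assms(2) by (intro end_arc[OF assms(1) e_def[symmetric] e(2)]) auto
  qed (use h e geodesic_arcD(1)[OF assms(1)] in auto)
  then show ?thesis by simp
qed

lemma excess_end_ge_2:
  assumes "geodesic_arc_of_cycle l q" "1 \<le> i" "2 * i + d (q 0) (q l) < l"
    and "\<not> (d (q 0) (q l) = 1 \<and> even l \<and> i = 1)"
  shows "2 \<le> excess (q i) (q l)"
proof -
  define e where "e = d (q 0) (q l)"
  have e: "1 \<le> e" "2 * i + e < l" "\<not> (e = 1 \<and> even l \<and> i = 1)"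
    using geodesic_arcD(3)[OF assms(1)] assms by (auto simp: e_def)
  define h where "h = (l + e) div 2"
  have h: "2 * h \<le> l + e" "l + e \<le> 2 * h + 1" by (auto simp: h_def)
  \<comment> \<open>This is the lower bound of \<open>end_arc\<close> for the second index
    \<open>i + h - 2\<close>. Rounding in \<open>h\<close> can lose 1, which matters only for
    \<open>e = i = 1\<close>, where odd \<open>l\<close> makes \<open>h\<close> exact.\<close>
  have "l + 4 \<le> 2 * i + 2 * h + e"
  proof (cases "e = 1 \<and> i = 1")
    case True
    with e(3) have "odd l" by simp
    then have "2 * h = l + e" using True by (simp add: h_def)
    with True show ?thesis by simp
  next
    case False
    with h e(1) assms(2) show ?thesis by linarith
  qed
  then have "d (q i) (q s) < d (q i) (q (Suc s)) \<and> d (q l) (q (Suc s)) < d (q l) (q s) \<and>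
      d (q i) (q l) < d (q i) (q s) + 1 + d (q (Suc s)) (q l)" if "s \<in> {i + h - 2, i + h - 1}" for s
    using that h e assms(2) by (intro end_arc[OF assms(1) e_def[symmetric] e(2)]) auto
  then have "card {i + h - 2, i + h - 1} \<le> excess (q i) (q l)"
    using h e assms(2) geodesic_arcD(1)[OF assms(1)] by (intro excess_ge_arcs[OF assms(1)]) auto
  then show ?thesis using h e assms(2) by simp
qed

section \<open>The gain of an ear\<close>

lemma conn_centerI:
  assumes "\<And>x. x \<in> S \<Longrightarrow> (c, x) \<in> {(u, w). u \<in> S \<and> w \<in> S \<and> adj u w}\<^sup>*"
  shows "conn S"
proof -
  let ?R = "{(u, w). u \<in> S \<and> w \<in> S \<and> adj u w}"
  have "sym (?R\<^sup>*)" by (intro sym_rtrancl symI) (auto intro: adj_sym)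
  then have "(x, c) \<in> ?R\<^sup>*" if "x \<in> S" for x using assms[OF that] by (rule symD)
  then show ?thesis
    unfolding conn_def using assms by (blast intro: rtrancl_trans)
qed

lemma conn_Un_adj:
  assumes "conn X" "\<And>b. b \<in> B \<Longrightarrow> \<exists>x \<in> X. adj x b"
  shows "conn (X \<union> B)"
proof (cases "X = {}")
  case True
  then have "B = {}" using assms(2) by blast
  with True show ?thesis by (simp add: conn_def)
next
  case False
  then obtain c where c: "c \<in> X" by blast
  let ?R = "\<lambda>S. {(u, w). u \<in> S \<and> w \<in> S \<and> adj u w}"
  have X: "(c, x) \<in> (?R (X \<union> B))\<^sup>*" if "x \<in> X" for x
  proof -
    have "(c, x) \<in> (?R X)\<^sup>*" using assms(1) c that by (simp add: conn_def)
    moreover have "?R X \<subseteq> ?R (X \<union> B)" by blast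
    ultimately show ?thesis using rtrancl_mono by blast
  qed
  show ?thesis
  proof (rule conn_centerI)
    fix x assume "x \<in> X \<union> B"
    then show "(c, x) \<in> (?R (X \<union> B))\<^sup>*"
    proof
      assume "x \<in> B"
      then obtain y where "y \<in> X" "adj y x" using assms(2) by blast
      then have "(y, x) \<in> ?R (X \<union> B)" using \<open>x \<in> B\<close> by simp
      with X[OF \<open>y \<in> X\<close>] show ?thesis by (rule rtrancl_into_rtrancl)
    qed (rule X)
  qed
qed

lemma conn_empty: "conn {}" and conn_singleton: "conn {x}"
  by (simp_all add: conn_def)

lemma conn_Un_path:
  assumes "conn X" "q 0 \<in> X" "\<And>i. Suc i < k \<Longrightarrow> adj (q i) (q (Suc i))"
  shows "conn (X \<union> q ` {1..<k})"
  using assms(3)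
proof (induction k)
  case 0
  then show ?case using assms by simp
next
  case (Suc k)
  show ?case
  proof (cases "k = 0")
    case True
    then show ?thesis using assms by simp
  next
    case False
    have "q (k - 1) \<in> X \<union> q ` {1..<k}"
      using assms(2) False by (cases "k = 1") auto
    moreover have "adj (q (k - 1)) (q k)" using Suc.prems[of "k - 1"] False by simp
    moreover have "conn (X \<union> q ` {1..<k})" using Suc by simp
    ultimately have "conn ((X \<union> q ` {1..<k}) \<union> {q k})" by (intro conn_Un_adj[where B = "{q k}"]) blast+
    moreover have "X \<union> q ` {1..<Suc k} = (X \<union> q ` {1..<k}) \<union> {q k}"
      using False by (auto simp: atLeastLessThanSuc)
    ultimately show ?thesis by simp
  qed
qed

text \<open>Without \<open>q k\<close> the interior falls into two pieces, one hanging on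
  \<open>q 0\<close> and one on \<open>q l\<close>. The values \<open>k = 0\<close> and
  \<open>k = l\<close> leave it in a single piece, for use when an end is missing from
  \<open>X\<close>.\<close>

lemma conn_Un_ear:
  assumes "ear S l q" "conn X" "k \<le> l" "0 < k \<Longrightarrow> q 0 \<in> X" "k < l \<Longrightarrow> q l \<in> X"
  shows "conn (X \<union> (q ` {1..<k} \<union> q ` {k<..<l}))"
proof -
  have A: "\<And>i. i < l \<Longrightarrow> adj (q i) (q (Suc i))" using assms(1) by (simp add: ear_def)
  have B: "\<And>i. i < l \<Longrightarrow> adj (q (l - i)) (q (l - Suc i))" using ear_rev[OF assms(1)] by (simp add: ear_def)
  have 1: "conn (X \<union> q ` {1..<k})"
  proof (cases "k = 0")
    case False
    then show ?thesis using assms A by (intro conn_Un_path) auto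
  qed (use assms in simp)
  show ?thesis
  proof (cases "k = l")
    case True
    then show ?thesis using 1 by simp
  next
    case False
    then have "conn ((X \<union> q ` {1..<k}) \<union> (\<lambda>i. q (l - i)) ` {1..<l - k})"
      using assms(3,5) B by (intro conn_Un_path[OF 1]) auto
    moreover have "(\<lambda>i. q (l - i)) ` {1..<l - k} = q ` {k<..<l}"
    proof -
      have "(\<lambda>i. l - i) ` {1..<l - k} = {k<..<l}"
      proof (intro subset_antisym subsetI)
        fix x assume "x \<in> {k<..<l}"
        then show "x \<in> (\<lambda>i. l - i) ` {1..<l - k}"
          by (intro image_eqI[of _ _ "l - x"]) auto
      qed (use assms(3) in auto)
      then show ?thesis by (simp flip: image_image[of q "\<lambda>i. l - i"])
    qed
    ultimately show ?thesis by (simp add: Un_assoc)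
  qed
qed

lemma biconn_Un_ear:
  assumes "biconn S" "ear S l q" "inj_on q {..l}"
  shows "biconn (S \<union> q ` {1..<l})"
proof -
  have ends: "q 0 \<in> S" "q l \<in> S" "q 0 \<noteq> q l" using assms(2) by (auto simp: ear_def)
  have out: "q i \<notin> S" if "i \<in> {1..<l}" for i using assms(2) that by (auto simp: ear_def)
  have "conn (S \<union> q ` {1..<l} - {z})" for z
  proof (cases "z \<in> q ` {1..<l}")
    case True
    then obtain k where k: "k \<in> {1..<l}" "z = q k" by blast
    have "conn (S \<union> (q ` {1..<k} \<union> q ` {k<..<l}))"
      using assms k ends by (intro conn_Un_ear[OF assms(2)]) (auto simp: biconn_def)
    moreover have "q ` ({1..<l} - {k}) = q ` {1..<l} - q ` {k}"
      by (rule inj_on_image_set_diff[OF assms(3)]) (use k in auto)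
    moreover have "{1..<l} - {k} = {1..<k} \<union> {k<..<l}" using k by auto
    moreover have "z \<notin> S" using out k by auto
    ultimately show ?thesis using k(2) by (simp add: Un_Diff image_Un)
  next
    case False
    have "conn ((S - {z}) \<union> q ` {1..<l})"
    proof (cases "z = q 0")
      case True
      then have "conn ((S - {z}) \<union> (q ` {1..<0} \<union> q ` {0<..<l}))"
        using assms ends by (intro conn_Un_ear[OF assms(2)]) (auto simp: biconn_def)
      moreover have "{0<..<l} = {1..<l}" by auto
      ultimately show ?thesis by simp
    next
      case False
      then have "conn ((S - {z}) \<union> (q ` {1..<l} \<union> q ` {l<..<l}))"
        using assms ends by (intro conn_Un_ear[OF assms(2)]) (auto simp: biconn_def)
      then show ?thesis by simp
    qed
    then show ?thesis using False by (simp add: Un_Diff)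
  qed
  moreover have "conn (S \<union> q ` {1..<l})"
  proof -
    have "conn (S \<union> (q ` {1..<l} \<union> q ` {l<..<l}))"
      using assms ends by (intro conn_Un_ear[OF assms(2)]) (auto simp: biconn_def)
    then show ?thesis by simp
  qed
  ultimately show ?thesis by (simp add: biconn_def)
qed

text \<open>If \<open>q i\<close> reaches one end faster round through the other, that end alone
  supplies the excess, up to the possible deficit. Otherwise geodesics to the two ends start with
  \<open>q (i - 1)\<close> and \<open>q (i + 1)\<close>, and \<open>sum_excess_ge_2_gates\<close>
  applies. The set \<open>S'\<close> is variable because the bound is also used over the two ends
  alone.\<close>

lemma excess_ear_ge:
  assumes "shortest_ear S l q" "S \<subseteq> V" "3 \<le> l" "S' \<subseteq> S" "conn S'" "q 0 \<in> S'" "q l \<in> S'"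
    and "1 \<le> i" "i < l"
  shows "2 \<le> (\<Sum>y\<in>S'. excess (q i) y) +
    (if d (q 0) (q l) = 1 \<and> even l \<and> (i = 1 \<or> i = l - 1) then 1 else 0)"
proof -
  define e where "e = d (q 0) (q l)"
  have G: "geodesic_arc_of_cycle l q" using shortest_ear_geodesic assms(1,2) by blast
  have G': "geodesic_arc_of_cycle l (\<lambda>i. q (l - i))"
    using shortest_ear_geodesic shortest_ear_rev assms(1,2) by blast
  note D = geodesic_arc_dist[OF G, folded e_def]
  have V: "\<And>i. i \<le> l \<Longrightarrow> q i \<in> V" using geodesic_arcD[OF G] by blast
  have e: "0 < e" "d (q l) (q 0) = e" using geodesic_arcD(3)[OF G] dist_sym[of "q l" "q 0"] V by (auto simp: e_def)
  have fin: "finite S'" using assms(2,4) finite_V by (meson finite_subset)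
  have le: "excess (q i) y \<le> (\<Sum>y\<in>S'. excess (q i) y)" if "y \<in> S'" for y
    by (rule member_le_sum[OF that _ fin]) simp
  consider "2 * i + e < l" | "2 * (l - i) + e < l" | "l \<le> 2 * i + e" "l \<le> 2 * (l - i) + e" by linarith
  then show ?thesis
  proof cases
    case 1
    then have "1 \<le> excess (q i) (q l)" "\<not> (e = 1 \<and> even l \<and> i = 1) \<Longrightarrow> 2 \<le> excess (q i) (q l)"
      using excess_end_ge_1[OF G assms(8)] excess_end_ge_2[OF G assms(8)] unfolding e_def by blast+
    then show ?thesis
      using le[OF assms(7)] unfolding e_def[symmetric] by fastforce
  next
    case 2
    have i: "1 \<le> l - i" "q (l - (l - i)) = q i" using assms(9) by auto
    have "1 \<le> excess (q i) (q 0)"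
      using excess_end_ge_1[OF G' i(1)] 2 e i(2) by simp
    moreover have "2 \<le> excess (q i) (q 0)" if "\<not> (e = 1 \<and> even l \<and> l - i = 1)"
      using excess_end_ge_2[OF G' i(1)] that 2 e i(2) by simp
    moreover have "l - i = 1 \<Longrightarrow> i = l - 1" using assms(9) by simp
    ultimately show ?thesis
      using le[OF assms(6)] unfolding e_def[symmetric] by fastforce
  next
    case 3
    have E: "ear S l q" using assms(1) by (simp add: shortest_ear_def)
    have A: "\<And>i. i < l \<Longrightarrow> adj (q i) (q (Suc i))" using geodesic_arcD[OF G] by blast
    have out: "q i \<in> V - S" using E assms(8,9) by (auto simp: ear_def)
    have "2 \<le> (\<Sum>y\<in>S'. excess (q i) y)"
    proof (rule sum_excess_ge_2_gates[OF assms(5) _ _ _ assms(6,7)])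
      show "q i \<in> V - S'" using out assms(4) by auto
      \<comment> \<open>Two neighbours in \<open>S\<close> would give exits of total length 2, less
        than \<open>l\<close>.\<close>
      show "z = z'" if "z \<in> S'" "z' \<in> S'" "adj (q i) z" "adj (q i) z'" for z z'
      proof (rule ccontr)
        assume "z \<noteq> z'"
        moreover have "exits S (q i) z (Suc 0)" "exits S (q i) z' (Suc 0)"
          using that out assms(4) by (auto intro: exits_step[OF _ _ exits_stop])
        ultimately have "l \<le> Suc 0 + Suc 0" using assms(1) unfolding shortest_ear_def by blast
        with assms(3) show False by simp
      qed
      have "adj (q i) (q (i - 1))" using A[of "i - 1"] assms(8,9) by (simp add: adj_sym)
      moreover have "d (q i) (q 0) = i" "d (q (i - 1)) (q 0) = i - 1"
        using D[of i 0] D[of "i - 1" 0] 3 assms(8,9) by (auto simp: min_def)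
      ultimately show "q (i - 1) \<in> gates (q i) (q 0)" using assms(8) by (simp add: gates_def)
      have "d (q i) (q l) = l - i" "d (q (Suc i)) (q l) = l - Suc i"
        using D[of i l] D[of "Suc i" l] 3 assms(8,9) by (auto simp: min_def)
      with A[of i] show "q (Suc i) \<in> gates (q i) (q l)" using assms(9) by (simp add: gates_def)
      show "q (i - 1) \<noteq> q (Suc i)"
      proof
        assume "q (i - 1) = q (Suc i)"
        then have "i - 1 = Suc i"
          using inj_onD[OF geodesic_arc_inj[OF G]] assms(8,9) by auto
        then show False by simp
      qed
    qed (use assms(2,4) in auto)
    then show ?thesis by simp
  qed
qed

lemma sum_excess_ear_ge:
  assumes "shortest_ear S l q" "S \<subseteq> V" "3 \<le> l" "S' \<subseteq> S" "conn S'" "q 0 \<in> S'" "q l \<in> S'"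
  shows "2 * (l - 1) \<le> (\<Sum>i=1..<l. \<Sum>y\<in>S'. excess (q i) y) +
    (if d (q 0) (q l) = 1 \<and> even l then 2 else 0)"
proof -
  let ?P = "d (q 0) (q l) = 1 \<and> even l"
  let ?\<delta> = "\<lambda>j i. if i = j then (if ?P then 1 else 0) else (0::nat)"
  have "2 * (l - 1) = (\<Sum>i=1..<l. 2)" by simp
  also have "\<dots> \<le> (\<Sum>i=1..<l. (\<Sum>y\<in>S'. excess (q i) y) + ?\<delta> 1 i + ?\<delta> (l - 1) i)"
  proof (rule sum_mono)
    fix i assume "i \<in> {1..<l}"
    then show "2 \<le> (\<Sum>y\<in>S'. excess (q i) y) + ?\<delta> 1 i + ?\<delta> (l - 1) i"
      using excess_ear_ge[OF assms, of i] by (auto split: if_splits)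
  qed
  also have "\<dots> = (\<Sum>i=1..<l. \<Sum>y\<in>S'. excess (q i) y) + (\<Sum>i=1..<l. ?\<delta> 1 i) + (\<Sum>i=1..<l. ?\<delta> (l - 1) i)"
    by (simp only: sum.distrib)
  also have "\<dots> = (\<Sum>i=1..<l. \<Sum>y\<in>S'. excess (q i) y) + (if ?P then 2 else 0)"
    using assms(3) by auto
  finally show ?thesis .
qed

text \<open>A path of length 3 through \<open>q 0\<close> and \<open>q l\<close> joins the two
  vertices, and for \<open>6 \<le> l\<close> the way along the ear is longer. The two middle arcs of
  the ear are good and surplus.\<close>

lemma excess_ear_ends_ge_2:
  assumes "geodesic_arc_of_cycle l q" "d (q 0) (q l) = 1" "even l" "6 \<le> l"
  shows "2 \<le> excess (q 1) (q (l - 1))"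
proof -
  obtain h where h: "l = 2 * h" using assms(3) by blast
  have V: "q i \<in> V" if "i \<le> l" for i using geodesic_arcD(1)[OF assms(1) that] .
  have D: "d (q i) (q j) = min (j - i) (i + 1 + (l - j))" if "i \<le> j" "j \<le> l" for i j
    using geodesic_arc_dist[OF assms(1), of i j] assms(2) that by simp
  have "d (q 1) (q s) < d (q 1) (q (Suc s)) \<and> d (q (l - 1)) (q (Suc s)) < d (q (l - 1)) (q s) \<and>
      d (q 1) (q (l - 1)) < d (q 1) (q s) + 1 + d (q (Suc s)) (q (l - 1))" if "s \<in> {h - 1, h}" for s
  proof -
    have s: "1 \<le> s" "s \<le> h" "h \<le> s + 1" using that h assms(4) by auto
    then have l: "s \<le> l" "Suc s \<le> l - 1" "Suc s \<le> l" "s \<le> l - 1" "l - 1 \<le> l" "1 \<le> Suc s" "1 \<le> l - 1"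
      using h assms(4) by auto
    have "d (q 1) (q s) = s - 1" "d (q 1) (q (Suc s)) = s" "d (q 1) (q (l - 1)) = 3"
      using D[OF s(1) l(1)] D[OF l(6,3)] D[OF l(7,5)] s h assms(4) by simp_all
    moreover have "d (q s) (q (l - 1)) = l - 1 - s" "d (q (Suc s)) (q (l - 1)) = l - 2 - s"
      using D[OF l(4,5)] D[OF l(2,5)] s h assms(4) by simp_all
    moreover have "d (q (l - 1)) (q s) = d (q s) (q (l - 1))"
      "d (q (l - 1)) (q (Suc s)) = d (q (Suc s)) (q (l - 1))"
      using V l by (auto intro!: dist_sym)
    ultimately show ?thesis using s h assms(4) by (intro conjI; linarith)
  qed
  then have "card {h - 1, h} \<le> excess (q 1) (q (l - 1))"
    using h assms(4) V by (intro excess_ge_arcs[OF assms(1)]) auto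
  then show ?thesis using h assms(4) by (cases h) auto
qed

text \<open>In the 5-cycle, the edge between \<open>q 0\<close> and \<open>q 4\<close> lies opposite
  to \<open>q 2\<close>; it is good for \<open>q 1\<close> and \<open>q 3\<close>, whose distance 2
  is attained through \<open>q 2\<close>.\<close>

lemma excess_ear_ends_ge_1:
  assumes "geodesic_arc_of_cycle 4 q" "d (q 0) (q 4) = 1"
  shows "1 \<le> excess (q 1) (q 3)"
proof -
  have V: "q i \<in> V" if "i \<le> 4" for i using geodesic_arcD(1)[OF assms(1) that] .
  have D: "d (q i) (q j) = min (j - i) (i + 1 + (4 - j))" if "i \<le> j" "j \<le> 4" for i j
    using geodesic_arc_dist[OF assms(1), of i j] assms(2) that by simp
  have "d (q 1) (q 0) = d (q 0) (q 1)" "d (q 3) (q 0) = d (q 0) (q 3)" "d (q 4) (q 3) = d (q 3) (q 4)"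
    using V by (auto intro!: dist_sym)
  then show ?thesis
    using D[of 0 1] D[of 1 4] D[of 3 4] D[of 0 3] D[of 1 3] V assms(2)
    by (intro excess_ge_1[of _ _ "q 0" "q 4"]) (simp_all add: adj_def)
qed

text \<open>The cases for the distances of \<open>q 2\<close> and \<open>q 3\<close> to
  \<open>y\<close> give, in turn: the adjacent vertices \<open>y\<close> and \<open>q 0\<close> at
  equal distance from \<open>q 2\<close> with different gates; two gates from \<open>q 2\<close> to
  \<open>y\<close>; the good edge from \<open>q 2\<close> to \<open>q 1\<close> for
  \<open>q 3\<close> and \<open>y\<close>.\<close>

lemma excess_ear_neighbour:
  assumes "shortest_ear S 4 q" "S \<subseteq> V" "d (q 0) (q 4) = 1" "y \<in> S" "y \<noteq> q 4" "adj (q 0) y"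
  shows "\<exists>i\<in>{1, 2, 3}. 1 \<le> excess (q i) y"
proof -
  have G: "geodesic_arc_of_cycle 4 q" using shortest_ear_geodesic assms(1,2) by blast
  have E: "ear S 4 q" using assms(1) by (simp add: shortest_ear_def)
  have M: "4 \<le> r + r'" if "exits S u z r" "exits S u z' r'" "z \<noteq> z'" for u z z' r r'
    using assms(1) that unfolding shortest_ear_def by blast
  have V: "q i \<in> V" if "i \<le> 4" for i using geodesic_arcD(1)[OF G that] .
  have D: "d (q i) (q j) = min (j - i) (i + 1 + (4 - j))" if "i \<le> j" "j \<le> 4" for i j
    using geodesic_arc_dist[OF G, of i j] assms(3) that by simp
  have A: "adj (q i) (q (Suc i))" if "i < 4" for i using geodesic_arcD(2)[OF G that] .
  have A4: "adj (q 0) (q 1)" "adj (q 1) (q 2)" "adj (q 2) (q 3)" "adj (q 3) (q 4)"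
    using A[of 0] A[of 1] A[of 2] A[of 3] by (simp_all add: numeral_eq_Suc)
  have S: "\<And>i. 0 < i \<and> i < 4 \<longrightarrow> q i \<notin> S" using E by (auto simp: ear_def)
  have y: "y \<in> V" "y \<noteq> q 0" using assms by (auto simp: adj_def)
  \<comment> \<open>Adjacency would give exits at \<open>y\<close> and \<open>q 0\<close> of total
    length \<open>i + 1\<close>, less than 4.\<close>
  have nadj: "\<not> adj (q i) y" if "i = 1 \<or> i = 2" for i
  proof
    assume "adj (q i) y"
    then have "exits S (q i) y (Suc 0)"
      using S that assms(4) by (intro exits_step[OF _ _ exits_stop]) auto
    moreover have "exits S (q i) (q 0) i" using ear_exits_left[OF E] that by auto
    ultimately show False using M y(2) that by fastforce
  qed
  have sym: "d (q 2) (q 0) = d (q 0) (q 2)" "d (q 1) (q 0) = d (q 0) (q 1)"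
    "d (q 3) (q 2) = d (q 2) (q 3)" "d (q 3) (q 1) = d (q 1) (q 3)"
    "d y (q 1) = d (q 1) y" "d y (q 2) = d (q 2) y"
    using V y by (auto intro!: dist_sym)
  have le: "d (q 1) y \<le> 2" "d (q 2) y \<le> 3" "d (q 3) y \<le> 3" "d (q 2) y \<le> Suc (d (q 3) y)"
  proof -
    have "d (q 0) y = 1" using assms(6) by (simp add: adj_def)
    moreover have "d (q 1) y \<le> Suc (d (q 0) y)" "d (q 2) y \<le> Suc (d (q 1) y)"
      "d (q 3) y \<le> Suc (d (q 4) y)" "d (q 4) y \<le> Suc (d (q 0) y)"
      using adj_dist_le(3)[OF A4(1) y(1)] adj_dist_le(3)[OF A4(2) y(1)] adj_dist_le(4)[OF A4(4) y(1)]
        adj_dist_le(3)[of "q 0" "q 4", OF _ y(1)] V assms(3) by (simp_all add: adj_def)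
    ultimately show "d (q 1) y \<le> 2" "d (q 2) y \<le> 3" "d (q 3) y \<le> 3" by linarith+
    show "d (q 2) y \<le> Suc (d (q 3) y)" using adj_dist_le(4)[OF A4(3) y(1)] .
  qed
  have ge: "2 \<le> d (q i) y" if "i = 1 \<or> i = 2" for i
    using dist_ge_2[of "q i" y] V y nadj[OF that] S assms(4) that by force
  have d1: "d (q 1) y = 2" using ge[of 1] le by simp
  consider "d (q 2) y = 2" | "d (q 2) y = 3" "d (q 3) y = 2" | "d (q 2) y = 3" "d (q 3) y = 3"
    using le ge[of 2] by linarith
  then show ?thesis
  proof cases
    case 1
    have "q 1 \<in> gates (q 2) (q 0)"
      using A4 sym D[of 0 2] D[of 0 1] by (simp add: gates_def adj_sym)
    moreover have "q 1 \<notin> gates (q 2) y" using d1 1 by (simp add: gates_def)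
    ultimately have "1 \<le> excess (q 2) y"
      using excess_ge_1_gate[of "q 2" y "q 0" "q 1"] assms(6) 1 V D[of 0 2] sym by (simp add: adj_sym)
    then show ?thesis by blast
  next
    case 2
    have "q 1 \<in> gates (q 2) y" "q 3 \<in> gates (q 2) y"
      using A4 2 d1 by (simp_all add: gates_def adj_sym)
    moreover have "q 1 \<noteq> q 3" using inj_onD[OF geodesic_arc_inj[OF G], of 1 3] by auto
    ultimately have "2 \<le> excess (q 2) y"
      using excess_ge_2_two_gates[of "q 2" y] V y 2 by auto
    then show ?thesis by (intro bexI[of _ 2]) auto
  next
    case 3
    have "d (q 2) (q 3) = 1" "d (q 1) (q 3) = 2" using D[of 2 3] D[of 1 3] by simp_all
    then have "1 \<le> excess (q 3) y"
      using A4 3 d1 V y sym by (intro excess_ge_1[of _ _ "q 2" "q 1"]) (simp_all add: adj_sym)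
    then show ?thesis by blast
  qed
qed

text \<open>Ordered pairs count every excess twice, so the bound kept during growth reads
  \<open>4 * card S \<le> total S + 12\<close>, free of subtraction.\<close>

definition total :: "'a set \<Rightarrow> nat" where
  "total S = (\<Sum>x\<in>S. \<Sum>y\<in>S. excess x y)"

lemma total_Un:
  assumes "A \<subseteq> V" "B \<subseteq> V" "A \<inter> B = {}"
  shows "total (A \<union> B) = total A + total B + 2 * (\<Sum>x\<in>B. \<Sum>y\<in>A. excess x y)"
proof -
  have fin: "finite A" "finite B" using assms finite_V finite_subset by blast+
  have "(\<Sum>x\<in>A. \<Sum>y\<in>B. excess x y) = (\<Sum>x\<in>A. \<Sum>y\<in>B. excess y x)"
    by (intro sum.cong refl excess_sym) (use assms in auto)
  also have "\<dots> = (\<Sum>x\<in>B. \<Sum>y\<in>A. excess x y)" by (rule sum.swap)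
  finally show ?thesis
    using fin assms(3) by (simp add: total_def sum.union_disjoint sum.distrib)
qed

lemma total_insert:
  assumes "S \<subseteq> V" "v \<in> V - S"
  shows "total (insert v S) = total S + 2 * (\<Sum>y\<in>S. excess v y)"
  using total_Un[of S "{v}"] assms by (simp add: total_def)

lemma total_ge_pair:
  assumes "S \<subseteq> V" "x \<in> S" "y \<in> S" "x \<noteq> y"
  shows "2 * excess x y \<le> total S"
proof -
  have V: "x \<in> V" "y \<in> V" using assms by auto
  have "S = (S - {x, y}) \<union> {x, y}" using assms by auto
  moreover have "total ((S - {x, y}) \<union> {x, y}) \<ge> total {x, y}"
    using assms by (subst total_Un) auto
  moreover have "total {x, y} = 2 * excess x y"
    using assms(4) V excess_sym[OF V] by (simp add: total_def)
  ultimately show ?thesis by simp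
qed

text \<open>A deficit occurs only for ears of even length on adjacent ends, where the first and the last
  new vertex \<open>q 1\<close> and \<open>q (l - 1)\<close> may have only excess 1 over \<open>S\<close>. Their mutual excess pays for it,
  except on a 5-cycle (\<open>l = 4\<close>), where a third vertex of \<open>S\<close> is needed.\<close>

lemma total_Un_ear:
  assumes "biconn S" "S \<subseteq> V" "3 \<le> card S" "shortest_ear S l q" "3 \<le> l"
  shows "total S + 4 * (l - 1) \<le> total (S \<union> q ` {1..<l})"
proof -
  have G: "geodesic_arc_of_cycle l q" using shortest_ear_geodesic assms(2,4) by blast
  have E: "ear S l q" using assms(4) by (simp add: shortest_ear_def)
  have ends: "q 0 \<in> S" "q l \<in> S" "q 0 \<noteq> q l" using E by (auto simp: ear_def)
  define Q where "Q = q ` {1..<l}"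
  have Q: "Q \<subseteq> V" "S \<inter> Q = {}" using E by (auto simp: Q_def ear_def)
  have inj: "inj_on q {1..<l}" by (rule inj_on_subset[OF geodesic_arc_inj[OF G]]) auto
  have fin: "finite S" using assms(2) finite_V finite_subset by blast
  have conn: "conn S" using assms(1) by (simp add: biconn_def)
  define \<Sigma> where "\<Sigma> = (\<Sum>i=1..<l. \<Sum>y\<in>S. excess (q i) y)"
  have "(\<Sum>x\<in>Q. \<Sum>y\<in>S. excess x y) = \<Sigma>"
    unfolding Q_def \<Sigma>_def by (simp only: sum.reindex[OF inj] o_def)
  then have tot: "total (S \<union> Q) = total S + total Q + 2 * \<Sigma>"
    using total_Un[OF assms(2) Q] by simp
  have sum: "2 * (l - 1) \<le> \<Sigma> + (if d (q 0) (q l) = 1 \<and> even l then 2 else 0)"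
    using sum_excess_ear_ge[OF assms(4,2,5) subset_refl conn ends(1,2)] by (simp add: \<Sigma>_def)
  show ?thesis
  proof (cases "d (q 0) (q l) = 1 \<and> even l")
    case False
    then have "2 * (l - 1) \<le> \<Sigma>" using sum by (simp only: if_False add_0_right)
    then show ?thesis unfolding Q_def[symmetric] using tot by linarith
  next
    case True
    then have sum': "2 * (l - 1) \<le> \<Sigma> + 2" using sum by (simp only: if_True simp_thms)
    from True have "even l" and d1: "d (q 0) (q l) = 1" by auto
    with assms(5) have "4 \<le> l" by presburger
    then have l1: "1 \<in> {1..<l}" "l - 1 \<in> {1..<l}" "1 \<noteq> l - 1" by auto
    then have "q 1 \<in> Q" "q (l - 1) \<in> Q" "q 1 \<noteq> q (l - 1)"
      using inj_on_eq_iff[OF inj l1(1,2)] unfolding Q_def by blast+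
    then have pair: "2 * excess (q 1) (q (l - 1)) \<le> total Q" using total_ge_pair[OF Q(1)] by blast
    show ?thesis
    proof (cases "l = 4")
      case False
      with \<open>4 \<le> l\<close> \<open>even l\<close> have "6 \<le> l" by presburger
      then have "2 \<le> excess (q 1) (q (l - 1))"
        using excess_ear_ends_ge_2[OF G] True by blast
      then show ?thesis unfolding Q_def[symmetric] using pair tot sum' by linarith
    next
      case l: True
      have "1 \<le> excess (q 1) (q 3)" using excess_ear_ends_ge_1 G d1 l by blast
      with pair l have "2 \<le> total Q" by simp
      \<comment> \<open>Connectedness of \<open>S\<close> yields a third vertex \<open>y\<close>
        adjacent to an end of the ear, to which \<open>excess_ear_neighbour\<close> applies, after
        reversal if that end is \<open>q l\<close>.\<close>
      have "\<exists>y\<in>S - {q 0, q l}. \<exists>i\<in>{1..<l}. 1 \<le> excess (q i) y"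
      proof -
        have "\<not> S \<subseteq> {q 0, q l}"
          using assms(3) card_mono[of "{q 0, q l}" S] ends(3) by auto
        then obtain w where w: "w \<in> S" "w \<noteq> q 0" "w \<noteq> q l" by blast
        have "\<exists>y\<in>S - {q 0, q l}. adj (q 0) y \<or> adj (q l) y"
        proof (rule ccontr)
          assume no: "\<not> ?thesis"
          from conn ends(1) w(1) have "w \<in> {q 0, q l}"
            by (induction rule: conn_induct[where x = "q 0" and y = w]) (use no in auto)
          with w show False by simp
        qed
        then obtain y where y: "y \<in> S" "y \<noteq> q 0" "y \<noteq> q l" "adj (q 0) y \<or> adj (q l) y" by blast
        from y(4) show ?thesis
        proof
          assume "adj (q 0) y"
          then obtain i where "i \<in> {1, 2, 3}" "1 \<le> excess (q i) y"
            using excess_ear_neighbour[of S q y] assms(2,4) d1 y l by auto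
          with y l show ?thesis by (intro bexI[of _ y] bexI[of _ i]) auto
        next
          assume "adj (q l) y"
          moreover have "d (q l) (q 0) = 1"
            using d1 dist_sym[of "q l" "q 0"] ends assms(2) by auto
          ultimately have "\<exists>i\<in>{1, 2, 3}. 1 \<le> excess (q (4 - i)) y"
            using excess_ear_neighbour[of S "\<lambda>i. q (4 - i)" y] shortest_ear_rev[OF assms(4)] assms(2) y l
            by simp
          then obtain i where "i \<in> {1, 2, 3}" "1 \<le> excess (q (4 - i)) y" by blast
          with y l show ?thesis by (intro bexI[of _ y] bexI[of _ "4 - i"]) auto
        qed
      qed
      then obtain y i where yi: "y \<in> S - {q 0, q l}" "i \<in> {1..<l}" "1 \<le> excess (q i) y" by blast
      have "adj (q 0) (q l)" using d1 ends assms(2) by (auto simp: adj_def)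
      then have "conn {q 0, q l}"
        using conn_Un_adj[OF conn_singleton[of "q 0"], of "{q l}"] by (simp add: insert_commute)
      \<comment> \<open>The bound is taken over the two ends only, so that the excess at
        \<open>y\<close> comes on top. A deficit of 1 may remain in \<open>\<Sigma>\<close>; it
        counts twice in the total and is covered by \<open>total Q\<close>.\<close>
      from sum_excess_ear_ge[OF assms(4,2,5) _ this] ends
      have "2 * (l - 1) \<le> (\<Sum>i=1..<l. \<Sum>z\<in>{q 0, q l}. excess (q i) z) + 2"
        by (auto split: if_splits)
      moreover have "(\<Sum>i=1..<l. \<Sum>z\<in>{q 0, q l}. excess (q i) z) + (\<Sum>i=1..<l. excess (q i) y) =
          (\<Sum>i=1..<l. \<Sum>z\<in>{y, q 0, q l}. excess (q i) z)"
        using yi(1) by (simp add: sum.distrib)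
      moreover have "\<dots> \<le> \<Sigma>"
        unfolding \<Sigma>_def using yi(1) ends fin by (intro sum_mono sum_mono2) auto
      moreover have "1 \<le> (\<Sum>i=1..<l. excess (q i) y)"
        using member_le_sum[OF yi(2), of "\<lambda>i. excess (q i) y"] yi(3) by simp
      ultimately have "2 * (l - 1) \<le> \<Sigma> + 1" by linarith
      then show ?thesis unfolding Q_def[symmetric] using \<open>2 \<le> total Q\<close> tot by linarith
    qed
  qed
qed

section \<open>Growing a 2-connected set\<close>

lemma biconn_insert:
  assumes "biconn S" "b \<in> S" "b' \<in> S" "b \<noteq> b'" "adj v b" "adj v b'"
  shows "biconn (insert v S)"
proof -
  have "conn (insert v S - {z})" for z
  proof (cases "z = v")
    case True
    then show ?thesis using assms(1) by (simp add: biconn_def)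
  next
    case False
    have "conn ((S - {z}) \<union> {v})"
    proof (rule conn_Un_adj)
      show "conn (S - {z})" using assms(1) by (simp add: biconn_def)
      show "\<exists>x\<in>S - {z}. adj x u" if "u \<in> {v}" for u
        using assms that adj_sym by blast
    qed
    then show ?thesis using False by (simp add: insert_Diff_if)
  qed
  moreover have "conn (S \<union> {v})"
    by (rule conn_Un_adj) (use assms adj_sym in \<open>auto simp: biconn_def\<close>)
  ultimately show ?thesis by (simp add: biconn_def)
qed

lemma biconn_edge:
  assumes "adj a b"
  shows "biconn {a, b}"
proof -
  have ab: "conn {a, b}"
    using conn_Un_adj[OF conn_singleton[of a], of "{b}"] assms by (simp add: insert_commute)
  have "{a, b} - {z} = {} \<or> {a, b} - {z} = {a} \<or> {a, b} - {z} = {b} \<or> {a, b} - {z} = {a, b}" for z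
    by auto
  then have "conn ({a, b} - {z})" for z
    using ab conn_singleton conn_empty by metis
  with ab show ?thesis by (simp add: biconn_def)
qed

text \<open>A vertex outside \<open>S\<close> misses \<open>x\<close> or \<open>y\<close>, so it
  gains excess 2 as soon as it has two neighbours in \<open>S\<close>. If there is no such vertex, a
  shortest ear has length at least 3 and is added whole. Either way \<open>total\<close> grows by at
  least 4 per new vertex.\<close>

lemma biconn_extend:
  assumes "biconn V" "S \<subset> V" "biconn S" "3 \<le> card S" "x \<in> S" "y \<in> S"
    and "\<And>v. adj v x \<Longrightarrow> adj v y \<Longrightarrow> v \<in> S"
  shows "\<exists>S'. S \<subset> S' \<and> S' \<subseteq> V \<and> biconn S' \<and> total S + 4 * card S' \<le> total S' + 4 * card S"
proof -
  have fin: "finite S" using assms(2) finite_V finite_subset by blast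
  show ?thesis
  proof (cases "\<exists>v\<in>V - S. \<exists>b\<in>S. \<exists>b'\<in>S. b \<noteq> b' \<and> adj v b \<and> adj v b'")
    case True
    then obtain v b b' where v: "v \<in> V - S" "b \<in> S" "b' \<in> S" "b \<noteq> b'" "adj v b" "adj v b'" by blast
    obtain u where "u \<in> S" "\<not> adj v u" using assms(5-7) v(1) by blast
    then have "2 \<le> (\<Sum>y\<in>S. excess v y)"
      using sum_excess_ge_2_biconn[OF assms(3) _ v(1) _ _ v(2-6)] assms(2) by blast
    then have "total S + 4 \<le> total (insert v S)"
      using total_insert[of S v] assms(2) v(1) by simp
    moreover have "card (insert v S) = card S + 1" using v(1) fin by simp
    ultimately show ?thesis
      using biconn_insert[OF assms(3) v(2-6)] assms(2) v(1)
      by (intro exI[of _ "insert v S"]) auto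
  next
    case False
    obtain v where v: "v \<in> V - S" using assms(2) by blast
    have "\<not> S \<subseteq> {x}" using assms(4) card_mono[of "{x}" S] by auto
    then obtain w where "w \<in> S" "w \<noteq> x" by blast
    then obtain l q where q: "shortest_ear S l q"
      using shortest_ear_exists[of S v w x] assms(1,2,5) v by blast
    then have E: "ear S l q" "2 \<le> l" by (auto simp: shortest_ear_def)
    have G: "geodesic_arc_of_cycle l q" using shortest_ear_geodesic q assms(2) by blast
    have "l \<noteq> 2"
    proof
      assume l: "l = 2"
      have "adj (q 0) (q 1)" "adj (q 1) (q 2)" "q 1 \<in> V - S" "q 0 \<in> S" "q 2 \<in> S" "q 0 \<noteq> q 2"
        using E(1) l by (auto simp: ear_def numeral_2_eq_2)
      with False show False using adj_sym by blast
    qed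
    with E(2) have "3 \<le> l" by simp
    have inj: "inj_on q {1..<l}" by (rule inj_on_subset[OF geodesic_arc_inj[OF G]]) auto
    have Q: "q ` {1..<l} \<subseteq> V - S" "q 1 \<in> q ` {1..<l}"
      using E by (auto simp: ear_def)
    have "card (S \<union> q ` {1..<l}) = card S + (l - 1)"
      using fin Q card_image[OF inj] by (subst card_Un_disjoint) auto
    moreover have "total S + 4 * (l - 1) \<le> total (S \<union> q ` {1..<l})"
      using total_Un_ear[OF assms(3) _ assms(4) q \<open>3 \<le> l\<close>] assms(2) by blast
    moreover have "biconn (S \<union> q ` {1..<l})"
      using biconn_Un_ear[OF assms(3) E(1) geodesic_arc_inj[OF G]] .
    ultimately show ?thesis
      using Q assms(2) by (intro exI[of _ "S \<union> q ` {1..<l}"]) auto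
  qed
qed

text \<open>Every larger set still contains all common neighbours of \<open>x\<close> and
  \<open>y\<close>, so \<open>biconn_extend\<close> can be repeated until \<open>V\<close> is
  reached.\<close>

lemma total_ge_if_base:
  assumes "biconn V" "S \<subseteq> V" "biconn S" "3 \<le> card S" "4 * card S \<le> total S + 12"
    and "x \<in> S" "y \<in> S" "\<And>v. adj v x \<Longrightarrow> adj v y \<Longrightarrow> v \<in> S"
  shows "4 * card V \<le> total V + 12"
  using assms(2-)
proof (induction "card (V - S)" arbitrary: S rule: less_induct)
  case (less S)
  show ?case
  proof (cases "S = V")
    case True
    then show ?thesis using less by simp
  next
    case False
    then have "S \<subset> V" using less by blast
    then obtain S' where S': "S \<subset> S'" "S' \<subseteq> V" "biconn S'"
      "total S + 4 * card S' \<le> total S' + 4 * card S"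
      using biconn_extend[OF assms(1), of S x y] less by blast
    have fin: "finite S'" using S'(2) finite_V finite_subset by blast
    have "card (V - S') < card (V - S)"
      using S' finite_V by (intro psubset_card_mono) auto
    moreover have "card S \<le> card S'" using S'(1) fin by (intro card_mono) auto
    ultimately show ?thesis
      using S' less(2-) by (intro less(1)[of S']) auto
  qed
qed

text \<open>The start consists of \<open>x\<close>, \<open>y\<close> and the set \<open>W\<close> of
  all their common neighbours. All \<open>2 * card W\<close> edges between the pair and
  \<open>W\<close> are good for \<open>x, y\<close>, while \<open>d x y = 2\<close>; the resulting
  excess is just enough.\<close>

lemma total_ge_two_common_neighbours:
  assumes "biconn V" "x \<in> V" "y \<in> V" "x \<noteq> y" "\<not> adj x y"
    and "w \<noteq> w'" "adj x w" "adj y w" "adj x w'" "adj y w'"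
  shows "4 * card V \<le> total V + 12"
proof -
  define W where "W = {w. adj x w \<and> adj y w}"
  have W: "W \<subseteq> V" "x \<notin> W" "y \<notin> W" "w \<in> W" "w' \<in> W" using assms adj_irrefl by (auto simp: W_def adj_def)
  have fin: "finite W" using W(1) finite_V finite_subset by blast
  have conn: "conn ({x, y} \<union> U)" if "U \<subseteq> W" "U \<noteq> {}" for U
  proof -
    have "conn ({x} \<union> U)"
      by (rule conn_Un_adj[OF conn_singleton]) (use that in \<open>auto simp: W_def\<close>)
    then have "conn (({x} \<union> U) \<union> {y})"
      by (rule conn_Un_adj) (use that in \<open>auto simp: W_def intro: adj_sym\<close>)
    moreover have "({x} \<union> U) \<union> {y} = {x, y} \<union> U" by auto
    ultimately show ?thesis by simp
  qed
  have star: "conn ({u} \<union> W)" if "u \<in> {x, y}" for u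
    by (rule conn_Un_adj[OF conn_singleton]) (use that in \<open>auto simp: W_def\<close>)
  let ?S = "{x, y} \<union> W"
  have "conn (?S - {z})" for z
  proof (cases "z \<in> {x, y}")
    case True
    then have "?S - {z} = {y} \<union> W \<or> ?S - {z} = {x} \<union> W" using W assms(4) by auto
    then show ?thesis using star[of x] star[of y] by fastforce
  next
    case False
    then have "?S - {z} = {x, y} \<union> (W - {z})" by auto
    moreover have "W - {z} \<noteq> {}" using W assms(6) by blast
    ultimately show ?thesis using conn[of "W - {z}"] by auto
  qed
  then have "biconn ?S" using conn[of W] W by (auto simp: biconn_def)
  have card: "card ?S = card W + 2" using fin W assms(4) by (subst card_Un_disjoint) auto
  have "card {w, w'} \<le> card W" using W fin by (intro card_mono) auto
  then have "2 \<le> card W" using assms(6) by simp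
  have dxy: "d x y = 2"
    using dist_ge_2[OF assms(2-5)] triangle[of x w y] assms(2,3,7,8) by (auto simp: adj_def dist_sym)
  let ?A = "Pair x ` W" and ?B = "(\<lambda>w. (w, y)) ` W"
  have "?A \<union> ?B \<subseteq> good x y"
    using dxy assms(2,3) by (auto simp: W_def good_def adj_def dist_sym)
  then have "card (?A \<union> ?B) \<le> card (good x y)" using finite_good by (intro card_mono) auto
  moreover have "card (?A \<union> ?B) = card ?A + card ?B"
    using fin W by (intro card_Un_disjoint) auto
  moreover have "card ?A = card W" "card ?B = card W" by (simp_all add: card_image inj_on_def)
  ultimately have "2 * card W - 2 \<le> excess x y" by (simp add: excess_def dxy)
  moreover have "2 * excess x y \<le> total ?S"
    using W assms(2-4) by (intro total_ge_pair) auto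
  ultimately have "4 * card ?S \<le> total ?S + 12" using card \<open>2 \<le> card W\<close> by linarith
  then show ?thesis
    using total_ge_if_base[OF assms(1) _ \<open>biconn ?S\<close>, of x y] card \<open>2 \<le> card W\<close> W assms(2,3)
    by (auto simp: W_def adj_sym)
qed

text \<open>Without two non-adjacent vertices with two common neighbours, a vertex outside a maximal
  clique has at most one neighbour in it, and a shortest ear on the clique closes to a cycle of
  length at least 5.\<close>

lemma total_ge_unique_common_neighbour:
  assumes "biconn V" "x \<in> V" "y \<in> V" "x \<noteq> y" "\<not> adj x y"
    and uniq: "\<And>u v w w'. u \<in> V \<Longrightarrow> v \<in> V \<Longrightarrow> u \<noteq> v \<Longrightarrow> \<not> adj u v \<Longrightarrow>
      adj u w \<Longrightarrow> adj v w \<Longrightarrow> adj u w' \<Longrightarrow> adj v w' \<Longrightarrow> w = w'"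
  shows "4 * card V \<le> total V + 12"
proof -
  define \<K> where "\<K> = {K. K \<subseteq> V \<and> (\<forall>u\<in>K. \<forall>w\<in>K. u \<noteq> w \<longrightarrow> adj u w)}"
  obtain g where "adj x g" using gates_nonempty[OF assms(2-4)] by (auto simp: gates_def)
  then have "{x, g} \<in> \<K>" by (auto simp: \<K>_def adj_def dist_sym)
  moreover have "finite \<K>" unfolding \<K>_def using finite_V by simp
  ultimately obtain K where K: "K \<in> \<K>" "{x, g} \<subseteq> K" and max: "\<And>K'. K' \<in> \<K> \<Longrightarrow> K \<subseteq> K' \<Longrightarrow> K = K'"
    using finite_has_maximal2[of \<K> "{x, g}"] by blast
  have KV: "K \<subseteq> V" and clique: "\<And>u w. u \<in> K \<Longrightarrow> w \<in> K \<Longrightarrow> u \<noteq> w \<Longrightarrow> adj u w"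
    using K(1) by (auto simp: \<K>_def)
  have "y \<in> V - K" using clique[of x y] K(2) assms(3-5) by auto
  moreover have "x \<noteq> g" using \<open>adj x g\<close> adj_irrefl by blast
  ultimately obtain l q where q: "shortest_ear K l q"
    using shortest_ear_exists[of K y x g] KV K(2) assms(1) by blast
  then have E: "ear K l q" "2 \<le> l" by (auto simp: shortest_ear_def)
  have G: "geodesic_arc_of_cycle l q" using shortest_ear_geodesic q KV by blast
  have ends: "q 0 \<in> K" "q l \<in> K" "q 0 \<noteq> q l" using E by (auto simp: ear_def)
  have A: "adj (q i) (q (Suc i))" if "i < l" for i using geodesic_arcD(2)[OF G that] .
  have V: "q i \<in> V" if "i \<le> l" for i using geodesic_arcD(1)[OF G that] .
  have out: "q i \<notin> K" if "0 < i" "i < l" for i using E that by (auto simp: ear_def)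
  have e: "adj (q 0) (q l)" using clique ends by blast
  then have d1: "d (q 0) (q l) = 1" by (simp add: adj_def)
  have D: "d (q i) (q j) = min (j - i) (i + 1 + (l - j))" if "i \<le> j" "j \<le> l" for i j
    using geodesic_arc_dist[OF G, of i j] d1 that by simp
  have "l \<noteq> 2"
  proof
    assume l: "l = 2"
    have a: "adj (q 1) (q 0)" "adj (q 1) (q 2)" using A[of 0] A[of 1] l by (simp_all add: adj_sym numeral_2_eq_2)
    \<comment> \<open>By maximality some \<open>c\<close> in the clique is not adjacent to
      \<open>q 1\<close>; then \<open>q 1\<close> and \<open>c\<close> have both \<open>q 0\<close>
      and \<open>q 2\<close> as common neighbours.\<close>
    have "insert (q 1) K \<notin> \<K>" using max[of "insert (q 1) K"] out[of 1] l by auto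
    moreover have "insert (q 1) K \<in> \<K>" if "\<And>c. c \<in> K \<Longrightarrow> adj (q 1) c"
      using that adj_sym[OF that] clique V[of 1] KV l by (auto simp: \<K>_def)
    ultimately obtain c where c: "c \<in> K" "\<not> adj (q 1) c" by blast
    have "c \<noteq> q 0" "c \<noteq> q 2" using a c by auto
    then have "adj c (q 0)" "adj c (q 2)" using clique c(1) ends l by auto
    then have "q 0 = q 2"
      using uniq[of "q 1" c "q 0" "q 2"] a c V[of 1] KV l out[of 1] by auto
    with ends l show False by simp
  qed
  moreover have "l \<noteq> 3"
  proof
    assume l: "l = 3"
    \<comment> \<open>In the resulting 4-cycle, \<open>q 1\<close> and \<open>q 3\<close> are not
      adjacent and share \<open>q 0\<close> and \<open>q 2\<close>.\<close>
    have "d (q 1) (q 3) = 2" using D[of 1 3] l by simp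
    then have "\<not> adj (q 1) (q 3)" "q 1 \<noteq> q 3" using V[of 3] l by (auto simp: adj_def)
    moreover have "adj (q 1) (q 0)" "adj (q 1) (q 2)" "adj (q 3) (q 2)" "adj (q 3) (q 0)"
      using A[of 0] A[of 1] A[of 2] e l by (simp_all add: adj_sym numeral_eq_Suc)
    ultimately have "q 0 = q 2" using uniq[of "q 1" "q 3" "q 0" "q 2"] V l by auto
    with ends(1) out[of 2] l show False by simp
  qed
  ultimately have l: "4 \<le> l" using E(2) by linarith
  let ?K = "{q 0, q l}" and ?Q = "q ` {1..<l}"
  have Q: "?Q \<subseteq> V" "?K \<inter> ?Q = {}" using V out ends by (auto 4 4)
  have inj: "inj_on q {1..<l}" by (rule inj_on_subset[OF geodesic_arc_inj[OF G]]) auto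
  have "(\<Sum>u\<in>?Q. \<Sum>z\<in>?K. excess u z) = (\<Sum>i=1..<l. \<Sum>z\<in>?K. excess (q i) z)"
    by (simp only: sum.reindex[OF inj] o_def)
  moreover have "2 * (l - 1) \<le> (\<Sum>i=1..<l. \<Sum>z\<in>?K. excess (q i) z) + 2"
  proof -
    have "conn ?K" using biconn_edge[OF e] by (simp add: biconn_def)
    moreover have "?K \<subseteq> K" "3 \<le> l" using ends l by auto
    ultimately have "2 * (l - 1) \<le> (\<Sum>i=1..<l. \<Sum>z\<in>?K. excess (q i) z) +
        (if d (q 0) (q l) = 1 \<and> even l then 2 else 0)"
      using sum_excess_ear_ge[OF q KV] by blast
    then show ?thesis by (auto split: if_splits)
  qed
  moreover have "total (?K \<union> ?Q) = total ?K + total ?Q + 2 * (\<Sum>u\<in>?Q. \<Sum>z\<in>?K. excess u z)"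
    by (rule total_Un) (use Q ends KV in auto)
  \<comment> \<open>For the \<open>l + 1\<close> vertices of the cycle,
    \<open>4 * (l + 1) - 12 = 4 * l - 8\<close> is needed, which is exactly this bound.\<close>
  ultimately have "2 * (2 * (l - 1)) \<le> total (?K \<union> ?Q) + 4" by linarith
  moreover have card: "card (?K \<union> ?Q) = l + 1"
    using Q(2) card_image[OF inj] ends(3) l by (subst card_Un_disjoint) auto
  ultimately have "4 * card (?K \<union> ?Q) \<le> total (?K \<union> ?Q) + 12" using l by linarith
  moreover have "biconn (?K \<union> ?Q)"
  proof (rule biconn_Un_ear[OF biconn_edge[OF e] _ geodesic_arc_inj[OF G]])
    have "q i \<in> V - ?K" if "0 < i \<and> i < l" for i
      using V[of i] out[of i] ends that by auto
    then show "ear ?K l q" using A ends(3) by (simp add: ear_def)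
  qed
  \<comment> \<open>The pair kept for the growth is \<open>q 0\<close> and \<open>q 2\<close>, not
    adjacent and with \<open>q 1\<close> as only common neighbour.\<close>
  moreover have "v \<in> ?K \<union> ?Q" if "adj v (q 0)" "adj v (q 2)" for v
  proof -
    have "d (q 0) (q 2) = 2" using D[of 0 2] l by simp
    then have "\<not> adj (q 0) (q 2)" "q 0 \<noteq> q 2" using V[of 2] l by (auto simp: adj_def)
    moreover have "adj (q 0) (q 1)" "adj (q 2) (q 1)"
      using A[of 0] A[of 1] l by (simp_all add: adj_sym numeral_2_eq_2)
    ultimately have "v = q 1"
      using uniq[of "q 0" "q 2" v "q 1"] that V[of 0] V[of 2] l by (auto simp: adj_sym)
    then show ?thesis using l by auto
  qed
  moreover have "q 0 \<in> ?K \<union> ?Q" "q 2 \<in> ?K \<union> ?Q" "?K \<union> ?Q \<subseteq> V" using l Q(1) ends KV by auto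
  ultimately show ?thesis
    using total_ge_if_base[OF assms(1), of "?K \<union> ?Q" "q 0" "q 2"] card l by simp
qed

lemma total_ge:
  assumes "biconn V" "x \<in> V" "y \<in> V" "x \<noteq> y" "\<not> adj x y"
  shows "4 * card V \<le> total V + 12"
  using total_ge_two_common_neighbours[OF assms(1)] total_ge_unique_common_neighbour[OF assms] by blast

end

section \<open>The distance of a graph\<close>

lemma sum_ordered_pairs_eq_2_sum_pairs:
  fixes f :: "'a \<Rightarrow> 'a \<Rightarrow> nat"
  assumes "finite R" "sym R" "irrefl R" "\<And>a b. on_pair f {a, b} = f a b"
  shows "(\<Sum>(a, b)\<in>R. f a b) = 2 * (\<Sum>e\<in>(\<lambda>(a, b). {a, b}) ` R. on_pair f e)"
proof -
  let ?g = "\<lambda>(a, b). {a, b}"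
  have "(\<Sum>(a, b)\<in>R. f a b) = (\<Sum>e\<in>?g ` R. \<Sum>p\<in>{p \<in> R. ?g p = e}. case p of (a, b) \<Rightarrow> f a b)"
    by (rule sum.image_gen[OF assms(1)])
  also have "\<dots> = (\<Sum>e\<in>?g ` R. 2 * on_pair f e)"
  proof (rule sum.cong[OF refl])
    fix e assume "e \<in> ?g ` R"
    then obtain a b where ab: "(a, b) \<in> R" "e = {a, b}" by auto
    then have ne: "a \<noteq> b" "(b, a) \<in> R" using assms(2,3) by (auto simp: irrefl_def dest: symD)
    then have "{p \<in> R. ?g p = e} = {(a, b), (b, a)}" using ab by (auto simp: doubleton_eq_iff)
    \<comment> \<open>Symmetry of \<open>f\<close> comes from evaluating \<open>on_pair\<close> at
      \<open>{a, b} = {b, a}\<close>.\<close>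
    moreover have "f b a = f a b" using assms(4)[of a b] assms(4)[of b a] by (simp add: insert_commute)
    ultimately show "(\<Sum>p\<in>{p \<in> R. ?g p = e}. case p of (a, b) \<Rightarrow> f a b) = 2 * on_pair f e"
      using ne ab(2) assms(4) by simp
  qed
  finally show ?thesis by (simp add: sum_distrib_left)
qed

lemma sum_card_swap:
  assumes "finite A" "finite B"
  shows "(\<Sum>a\<in>A. card {b \<in> B. P a b}) = (\<Sum>b\<in>B. card {a \<in> A. P a b})"
proof -
  have "(\<Sum>a\<in>A. card {b \<in> B. P a b}) = (\<Sum>a\<in>A. \<Sum>b\<in>B. if P a b then 1 else 0)"
    by (simp only: card_eq_sum sum.inter_filter[OF assms(2)])
  also have "\<dots> = (\<Sum>b\<in>B. \<Sum>a\<in>A. if P a b then 1 else 0)" by (rule sum.swap)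
  also have "\<dots> = (\<Sum>b\<in>B. card {a \<in> A. P a b})"
    by (simp only: card_eq_sum sum.inter_filter[OF assms(1)])
  finally show ?thesis .
qed

context pair_graph
begin

lemma length_awalk_to_apath_le:
  assumes "awalk u p v"
  shows "length (awalk_to_apath p) \<le> length p"
  using assms
proof (induct rule: awalk_to_apath_induct)
  case (path p)
  then have "awalk_to_apath p = p"
    by (auto simp: awalk_to_apath.simps)
  then show ?case by simp
next
  case (decomp p q r s)
  then have "awalk_to_apath p = awalk_to_apath (q @ s)"
    using step_awalk_to_apath[of u p v q r s] by simp
  moreover have "length (q @ s) \<le> length p"
    using decomp by (auto elim!: awalk_cyc_decompE)
  ultimately show ?case using decomp by simp
qed

text \<open>\<open>gdist\<close> is a minimum over paths, but cutting the cycles out of a walk does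
  not lengthen it. Concatenations, which need not be paths, thus give the triangle
  inequality.\<close>

lemma gdist_le_length: "awalk a p b \<Longrightarrow> gdist G a b \<le> length p"
proof -
  assume p: "awalk a p b"
  then have "\<exists>q. apath a q b \<and> length q = length (awalk_to_apath p)"
    using apath_awalk_to_apath by blast
  then have "gdist G a b \<le> length (awalk_to_apath p)"
    unfolding gdist_def by (rule Least_le)
  also have "\<dots> \<le> length p" using p by (rule length_awalk_to_apath_le)
  finally show ?thesis .
qed

lemma gdist_apath:
  assumes "a \<rightarrow>\<^sup>*\<^bsub>with_proj G\<^esub> b"
  obtains p where "apath a p b" "length p = gdist G a b"
proof -
  have "\<exists>k p. apath a p b \<and> length p = k" using assms by (simp add: reachable_apath)
  then have "\<exists>p. apath a p b \<and> length p = gdist G a b"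
    unfolding gdist_def by (rule LeastI_ex)
  then show ?thesis using that by blast
qed

lemma gdist_eq_1_iff:
  assumes "a \<rightarrow>\<^sup>*\<^bsub>with_proj G\<^esub> b"
  shows "gdist G a b = 1 \<longleftrightarrow> (a, b) \<in> parcs G"
proof
  assume 1: "gdist G a b = 1"
  obtain p where "apath a p b" "length p = gdist G a b" by (rule gdist_apath[OF assms])
  with 1 obtain e where "apath a [e] b" by (auto simp: length_Suc_conv)
  then show "(a, b) \<in> parcs G" by (auto simp: apath_Cons_iff apath_Nil_iff)
next
  assume ab: "(a, b) \<in> parcs G"
  then have "awalk a [(a, b)] b" by (auto simp: awalk_Cons_iff awalk_Nil_iff wellformed')
  from gdist_le_length[OF this] have "gdist G a b \<le> 1" by simp
  moreover have "gdist G a b \<noteq> 0"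
  proof
    assume "gdist G a b = 0"
    moreover obtain p where "apath a p b" "length p = gdist G a b" by (rule gdist_apath[OF assms])
    ultimately show False using no_loops'[OF ab] by (auto simp: apath_Nil_iff)
  qed
  ultimately show "gdist G a b = 1" by simp
qed

lemma graph_metric_gdist:
  assumes reach: "\<And>a b. a \<in> pverts G \<Longrightarrow> b \<in> pverts G \<Longrightarrow> a \<rightarrow>\<^sup>*\<^bsub>with_proj G\<^esub> b"
  shows "graph_metric (pverts G) (gdist G)"
proof
  show "finite (pverts G)" by (rule pair_finite_verts)
  fix x y assume xy: "x \<in> pverts G" "y \<in> pverts G"
  obtain p where p: "apath x p y" "length p = gdist G x y"
    by (rule gdist_apath[OF reach[OF xy]])
  show "gdist G x y = gdist G y x" by (rule gdist_commute)
  show "gdist G x y = 0 \<longleftrightarrow> x = y"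
  proof
    assume "x = y"
    then show "gdist G x y = 0" using gdist_le_length[of x "[]" y] xy by (simp add: awalk_Nil_iff)
  qed (use p in \<open>auto simp: apath_Nil_iff\<close>)
  show tri: "gdist G x z \<le> gdist G x y + gdist G y z" if z: "z \<in> pverts G" for z
  proof -
    obtain p' where p': "apath y p' z" "length p' = gdist G y z"
      by (rule gdist_apath[OF reach[OF xy(2) z]])
    have "awalk x (p @ p') z"
      using awalk_appendI awalkI_apath[OF p(1)] awalkI_apath[OF p'(1)] by blast
    from gdist_le_length[OF this] show ?thesis using p(2) p'(2) by simp
  qed
  show "\<exists>g\<in>pverts G. gdist G x g = 1 \<and> Suc (gdist G g y) = gdist G x y" if "x \<noteq> y"
  proof -
    obtain e es where e: "p = e # es" using p(1) \<open>x \<noteq> y\<close> by (cases p) (auto simp: apath_Nil_iff)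
    then obtain g where g: "(x, g) \<in> parcs G" "awalk g es y"
      using awalkI_apath[OF p(1)] by (cases e) (auto simp: awalk_Cons_iff)
    have gV: "g \<in> pverts G" using g(1) by (rule in_arcsD2)
    have 1: "gdist G x g = 1" using gdist_eq_1_iff[OF reach] xy gV g(1) by simp
    have "gdist G g y \<le> length es" using gdist_le_length g(2) .
    moreover obtain p' where p': "apath g p' y" "length p' = gdist G g y"
      by (rule gdist_apath[OF reach[OF gV xy(2)]])
    have "awalk x ((x, g) # p') y" using g(1) awalkI_apath[OF p'(1)] by (auto simp: awalk_Cons_iff)
    then have "gdist G x y \<le> Suc (gdist G g y)"
      using gdist_le_length[of x "(x, g) # p'" y] p'(2) by simp
    ultimately show ?thesis using 1 gV p(2) e by (intro bexI[of _ g]) auto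
  qed
qed

text \<open>\<open>connected\<close> refers to the symmetric closure of a digraph, which adds no
  arcs because those of \<open>G\<close> are symmetric already.\<close>

lemma connected_induced_reachable:
  assumes "Digraph_Component.connected (with_proj G \<restriction> S)" "u \<in> S" "v \<in> S"
  shows "(u, v) \<in> {(a, b). a \<in> S \<and> b \<in> S \<and> (a, b) \<in> parcs G}\<^sup>*"
proof -
  let ?M = "mk_symmetric (with_proj G \<restriction> S)"
  have "u \<rightarrow>\<^sup>*\<^bsub>with_proj ?M\<^esub> v"
    using assms by (simp add: connected_def strongly_connected_def mk_symmetric_def)
  then have "(u, v) \<in> (parcs ?M)\<^sup>*"
    using reachable_rtranclI[of "with_proj ?M"] by simp
  moreover have "parcs ?M \<subseteq> {(a, b). a \<in> S \<and> b \<in> S \<and> (a, b) \<in> parcs G}"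
    by (auto simp: mk_symmetric_def induce_subgraph_def intro: arcs_symmetric)
  ultimately show ?thesis using rtrancl_mono by blast
qed

end

theorem theorem2:
  fixes G :: "'a pair_pre_digraph" and n :: nat
  assumes "pair_graph G"
    and "card (pverts G) = n"
    and "k_connected 2 G"
    and "\<not> complete_digraph n (with_proj G)"
  shows "eta G \<ge> 2 * int n - 6"
proof -
  interpret pair_graph G by fact
  define V where "V = pverts G"
  have finV: "finite V" unfolding V_def by (rule pair_finite_verts)
  have con: "Digraph_Component.connected (with_proj G \<restriction> (V - X))" if "X \<subseteq> V" "card X < 2" for X
    using assms(3) that by (simp add: k_connected_def V_def)
  have reach: "a \<rightarrow>\<^sup>*\<^bsub>with_proj G\<^esub> b" if "a \<in> V" "b \<in> V" for a b
  proof -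
    have "(a, b) \<in> {(a, b). a \<in> V \<and> b \<in> V \<and> (a, b) \<in> parcs G}\<^sup>*"
      using connected_induced_reachable[of V a b] con[of "{}"] that by simp
    then show ?thesis
      by (induction rule: rtrancl_induct) (use that in \<open>auto simp: V_def intro: reachable_adj_trans\<close>)
  qed
  interpret M: graph_metric V "gdist G"
    using graph_metric_gdist reach by (simp add: V_def)
  have adj: "M.adj a b \<longleftrightarrow> (a, b) \<in> parcs G" for a b
    unfolding M.adj_def using gdist_eq_1_iff[OF reach, of a b] in_arcsD1[of a b] in_arcsD2[of a b]
    by (auto simp: V_def)
  have "M.conn (V - X)" if "X \<subseteq> V" "card X < 2" for X
    unfolding M.conn_def adj using connected_induced_reachable[OF con[OF that]] by blast
  from this[of "{}"] this[of "{z}" for z] have "M.conn V" "\<And>z. z \<in> V \<Longrightarrow> M.conn (V - {z})" by simp_all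
  \<comment> \<open>For \<open>z\<close> outside \<open>V\<close>, nothing is deleted.\<close>
  then have "M.biconn V" unfolding M.biconn_def by (metis Diff_insert0 Diff_empty)
  moreover have "parcs G \<noteq> {(u, v). (u, v) \<in> V \<times> V \<and> u \<noteq> v}"
    using assms(2,4) pair_finite_verts by (simp add: complete_digraph_pair_def V_def)
  then obtain x y where "x \<in> V" "y \<in> V" "x \<noteq> y" "\<not> M.adj x y"
    using no_loops' in_arcsD1 in_arcsD2 unfolding adj by (auto simp: V_def)
  ultimately have "4 * card V \<le> M.total V + 12" by (rule M.total_ge)
  have wiener: "2 * wiener G = (\<Sum>x\<in>V. \<Sum>y\<in>V. gdist G x y)"
  proof -
    let ?R = "V \<times> V - Id"
    have "(\<lambda>(a, b). {a, b}) ` ?R = {e. e \<subseteq> V \<and> card e = 2}"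
      by (auto simp: card_2_iff image_iff)
    moreover have "finite ?R" "sym ?R" "irrefl ?R" using finV by (auto simp: sym_def irrefl_def)
    ultimately have "2 * wiener G = (\<Sum>(a, b)\<in>?R. gdist G a b)"
      using sum_ordered_pairs_eq_2_sum_pairs[of ?R "gdist G"] on_pair_gdist
      by (simp add: wiener_def V_def)
    \<comment> \<open>The diagonal may be added because it contributes distance 0.\<close>
    also have "\<dots> = (\<Sum>(a, b)\<in>V \<times> V. gdist G a b)"
      by (rule sum.mono_neutral_left) (use finV in auto)
    finally show ?thesis by (simp add: sum.cartesian_product)
  qed
  have szeged: "2 * szeged G = (\<Sum>x\<in>V. \<Sum>y\<in>V. card (M.good x y))"
  proof -
    let ?P = "\<lambda>(a, b) (x, y). gdist G x a < gdist G x b \<and> gdist G y b < gdist G y a"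
    have "edges G = (\<lambda>(a, b). {a, b}) ` parcs G" by (auto simp: edges_def image_iff)
    moreover have "sym (parcs G)" "irrefl (parcs G)"
      using no_loops' arcs_symmetric unfolding sym_def irrefl_def by blast+
    ultimately have "2 * szeged G = (\<Sum>(a, b)\<in>parcs G. n_closer G a b * n_closer G b a)"
      using sum_ordered_pairs_eq_2_sum_pairs[OF pair_finite_arcs _ _ on_pair_szeged]
      by (simp add: szeged_def)
    \<comment> \<open>The product counts the ordered pairs with first member nearer to
      \<open>a\<close> and second nearer to \<open>b\<close>. Exchanging the sums then counts the
      good edges of each pair.\<close>
    also have "\<dots> = (\<Sum>e\<in>parcs G. card {p \<in> V \<times> V. ?P e p})"
    proof (rule sum.cong[OF refl])
      fix e :: "'a \<times> 'a"
      obtain a b where e: "e = (a, b)" by (cases e)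
      have "{p \<in> V \<times> V. ?P (a, b) p} =
          {w \<in> V. gdist G w a < gdist G w b} \<times> {w \<in> V. gdist G w b < gdist G w a}" by auto
      then show "(case e of (a, b) \<Rightarrow> n_closer G a b * n_closer G b a) = card {p \<in> V \<times> V. ?P e p}"
        unfolding e by (simp only: n_closer_def V_def card_cartesian_product prod.case)
    qed
    also have "\<dots> = (\<Sum>p\<in>V \<times> V. card {e \<in> parcs G. ?P e p})"
      using finV pair_finite_arcs by (intro sum_card_swap) auto
    also have "\<dots> = (\<Sum>(x, y)\<in>V \<times> V. card (M.good x y))"
      by (intro sum.cong refl) (auto simp: M.good_def adj intro!: arg_cong[where f = card])
    finally show ?thesis by (simp add: sum.cartesian_product)
  qed
  \<comment> \<open>This identifies \<open>M.total V\<close> with twice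
    \<open>eta G\<close>.\<close>
  have "2 * szeged G = 2 * wiener G + M.total V"
  proof -
    have "card (M.good x y) = gdist G x y + M.excess x y" if "x \<in> V" "y \<in> V" for x y
      using M.dist_le_card_good[OF that] by (simp add: M.excess_def)
    then have "2 * szeged G = (\<Sum>x\<in>V. \<Sum>y\<in>V. gdist G x y + M.excess x y)"
      unfolding szeged by (intro sum.cong refl) auto
    then show ?thesis unfolding wiener M.total_def by (simp add: sum.distrib)
  qed
  with \<open>4 * card V \<le> M.total V + 12\<close> show ?thesis
    using assms(2) by (simp add: eta_def V_def)
qed

end
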